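(* Let $a>b>0$, $c^2=a^2-b^2$, and let $\mathcal{E}$ be the ellipse $x^2/a^2+y^2/b^2=1$. Let $\mathcal{E}_\triangle$ be the ellipse concentric and axis-aligned with $\mathcal{E}$ with semi-axes $a_\triangle=\frac{ac^2}{a^2+3b^2}$ (along $x$) and $b_\triangle=\frac{bc^2}{3a^2+b^2}$ (along $y$). For $C$ on $\mathcal{E}_\triangle$, let $\mathcal{L}_3$ be the (elliptic) locus of the circumcenter $X_3$ over the Poncelet family of triangles inscribed in $\mathcal{E}$ and circumscribing a circle centered at $C$, with semi-axis lengths $a_3$ (major) and $b_3$ (minor). Then the aspect ratio of $\mathcal{L}_3$ is the same for all $C$ on $\mathcal{E}_\triangle$ and is given by \[ \frac{a_3}{b_3}=\frac{(3a^2+b^2)(a^2+3b^2)(a^4-b^4)}{c^2(6a^5b+20a^3b^3+6ab^5)}. \]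
   Context: For each point $C=[x_c,y_c]$ interior to $\mathcal{E}$ there is exactly one circle $\mathcal{K}$ centered at $C$, nested in $\mathcal{E}$, admitting triangles inscribed in $\mathcal{E}$ with all sides tangent to $\mathcal{K}$; its radius is $r=\big(b\sqrt{a^4-c^2x_c^2}-a\sqrt{b^4+c^2y_c^2}\big)/c^2$. By Poncelet's porism every point of $\mathcal{E}$ is then a vertex of exactly one such triangle; the Poncelet family about the circle centered at $C$ is the family of all these triangles. The locus of a triangle center is the set of its positions as the triangle ranges over the family; it is known that $\mathcal{L}_3$ is an ellipse. $\mathcal{E}_\triangle$ is the locus of centroids of all equilateral triangles inscribed in $\mathcal{E}$. *)

theory Defs
  imports "HOL-Analysis.Analysis"
begin

text \<open>The Euclidean plane is identified with the complex numbers.\<close>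

definition axis_ellipse :: "real \<Rightarrow> real \<Rightarrow> complex set" where
  "axis_ellipse p q = {z. (Re z / p)\<^sup>2 + (Im z / q)\<^sup>2 = 1}"

definition axis_ellipse_interior :: "real \<Rightarrow> real \<Rightarrow> complex set" where
  "axis_ellipse_interior p q = {z. (Re z / p)\<^sup>2 + (Im z / q)\<^sup>2 < 1}"

text \<open>An ellipse in arbitrary position, with major semi-axis \<open>p\<close> and minor semi-axis \<open>q\<close>;
  circles (\<open>p = q\<close>) are allowed, degenerate ellipses are not.\<close>

definition is_ellipse_with_semi_axes :: "complex set \<Rightarrow> real \<Rightarrow> real \<Rightarrow> bool" where
  "is_ellipse_with_semi_axes S p q \<longleftrightarrow>
     q > 0 \<and> p \<ge> q \<and> (\<exists>z0 \<phi>. S = (\<lambda>z. z0 + cis \<phi> * z) ` axis_ellipse p q)"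

definition tangent_to_circle :: "complex set \<Rightarrow> complex \<Rightarrow> real \<Rightarrow> bool" where
  "tangent_to_circle l C r \<longleftrightarrow> (\<exists>T. l \<inter> sphere C r = {T})"

text \<open>The sides of a triangle enter through the lines that carry them. Since the circle
  is nested in the ellipse, its point of contact with such a line lies strictly between the
  two vertices, so tangency to the segment and to the line agree, and the circle is the
  incircle. The radius \<open>r\<close> is existentially quantified because it is determined by \<open>C\<close>;
  triangles are recorded as ordered triples of vertices.\<close>

definition poncelet_family ::
    "real \<Rightarrow> real \<Rightarrow> complex \<Rightarrow> (complex \<times> complex \<times> complex) set" where
  "poncelet_family a b C = {(P, Q, R).
     \<not> collinear {P, Q, R} \<and> {P, Q, R} \<subseteq> axis_ellipse a b \<and>
     (\<exists>r>0. cball C r \<subseteq> axis_ellipse_interior a b \<and>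
        tangent_to_circle (affine hull {P, Q}) C r \<and>
        tangent_to_circle (affine hull {Q, R}) C r \<and>
        tangent_to_circle (affine hull {R, P}) C r)}"

definition circumcenter :: "complex \<Rightarrow> complex \<Rightarrow> complex \<Rightarrow> complex" where
  "circumcenter P Q R = (THE X. dist X P = dist X Q \<and> dist X Q = dist X R)"

definition circumcenter_locus :: "real \<Rightarrow> real \<Rightarrow> complex \<Rightarrow> complex set" where
  "circumcenter_locus a b C =
     {circumcenter P Q R | P Q R. (P, Q, R) \<in> poncelet_family a b C}"

end

theory Submission
  imports Defs "HOL-Computational_Algebra.Fundamental_Theorem_Algebra"
begin

text \<open>Normalize the ellipse to the unit circle, so that the vertices become unit numbers
  \<open>u, v, w\<close>. Tangency of the sides to the circle about \<open>C\<close> is a symmetric (2,2)-correspondence between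
  \<open>u\<close> and \<open>v\<close>, and three closing steps mean that \<open>u, v, w\<close> are the solutions of a Blaschke equation
  \<open>x (x - f) (x - g) = l (1 - cnj f * x) (1 - cnj g * x)\<close>, where \<open>f, g\<close> are the foci of the
  normalized circle and \<open>l = u v w\<close> runs through the whole unit circle. In particular
  \<open>u + v + w = f + g + cnj (f g) * l\<close>, and since the circumcenter is a real-linear function of
  \<open>u + v + w\<close> and \<open>u v w\<close>, its locus is the image of the unit circle under
  \<open>l \<mapsto> z0 + A * l + B * cnj l\<close>, an ellipse with semi-axes \<open>norm A + norm B\<close> and
  \<open>norm A - norm B\<close>. For \<open>C\<close> on the ellipse of centroids,
  \<open>norm B / norm A = ((a - b) / (a + b))\<^sup>2\<close>, so the aspect ratio is \<open>(a\<^sup>2 + b\<^sup>2) / (2 a b)\<close>.\<close>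

section \<open>Collinearity, circumcenters and tangent lines in complex coordinates\<close>

lemma collinear_complex_iff:
  fixes P Q R :: complex
  shows "collinear {P, Q, R} \<longleftrightarrow> Im (cnj (Q - P) * (R - P)) = 0"
proof (cases "Q = P")
  case True
  then show ?thesis by simp
next
  case False
  then have D: "(norm (Q - P))\<^sup>2 \<noteq> 0" by simp
  have "collinear {P, Q, R} \<longleftrightarrow> (\<exists>t. R - P = t *\<^sub>R (Q - P))"
    using False by (simp add: collinear_3_affine_hull[of P Q R] affine_hull_2_alt image_iff
        diff_eq_eq add.commute)
  also have "\<dots> \<longleftrightarrow> Im (cnj (Q - P) * (R - P)) = 0"
  proof
    assume "Im (cnj (Q - P) * (R - P)) = 0"
    then have "cnj (Q - P) * (R - P) = of_real (Re (cnj (Q - P) * (R - P)))"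
      by (simp add: complex_eq_iff)
    then have "(norm (Q - P))\<^sup>2 * (R - P) = Re (cnj (Q - P) * (R - P)) * (Q - P)"
      by (metis (no_types, lifting) complex_norm_square mult.assoc mult.commute)
    then have "R - P = (Re (cnj (Q - P) * (R - P)) / (norm (Q - P))\<^sup>2) *\<^sub>R (Q - P)"
      using D by (simp add: scaleR_conv_of_real field_simps)
    then show "\<exists>t. R - P = t *\<^sub>R (Q - P)" by blast
  next
    assume "\<exists>t. R - P = t *\<^sub>R (Q - P)"
    then obtain t where t: "R - P = t *\<^sub>R (Q - P)" by blast
    show "Im (cnj (Q - P) * (R - P)) = 0" unfolding t by (simp add: algebra_simps)
  qed
  finally show ?thesis .
qed

text \<open>The difference of two equidistant points is orthogonal to both edges
  \<open>Q - P\<close> and \<open>R - P\<close>. These are linearly independent, so the difference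
  vanishes and the \<open>THE\<close> in \<open>circumcenter\<close> is well defined.\<close>

lemma circumcenter_eqI:
  assumes "\<not> collinear {P, Q, R}" "dist X P = dist X Q" "dist X Q = dist X R"
  shows "circumcenter P Q R = X"
  unfolding circumcenter_def
proof (rule the_equality)
  show "dist X P = dist X Q \<and> dist X Q = dist X R" using assms by simp
next
  fix Y assume Y: "dist Y P = dist Y Q \<and> dist Y Q = dist Y R"
  define d where "d = Y - X"
  have sq: "(dist A B)\<^sup>2 = (Re A - Re B)\<^sup>2 + (Im A - Im B)\<^sup>2" for A B :: complex
    by (simp add: dist_norm cmod_power2)
  have e: "(dist X P)\<^sup>2 = (dist X Q)\<^sup>2" "(dist X P)\<^sup>2 = (dist X R)\<^sup>2"
    "(dist Y P)\<^sup>2 = (dist Y Q)\<^sup>2" "(dist Y P)\<^sup>2 = (dist Y R)\<^sup>2"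
    using assms Y by simp_all
  have 1: "Re d * Re (Q - P) + Im d * Im (Q - P) = 0"
    using e(1,3) unfolding sq d_def by (simp add: power2_eq_square) algebra
  have 2: "Re d * Re (R - P) + Im d * Im (R - P) = 0"
    using e(2,4) unfolding sq d_def by (simp add: power2_eq_square) algebra
  have 3: "Re (Q - P) * Im (R - P) - Im (Q - P) * Re (R - P) \<noteq> 0"
    using assms(1) by (simp add: collinear_complex_iff algebra_simps)
  have "Re d * (Re (Q - P) * Im (R - P) - Im (Q - P) * Re (R - P)) = 0"
    using 1 2 by algebra
  moreover have "Im d * (Re (Q - P) * Im (R - P) - Im (Q - P) * Re (R - P)) = 0"
    using 1 2 by algebra
  ultimately have "d = 0" using 3 by (simp add: complex_eq_iff)
  then show "Y = X" by (simp add: d_def)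
qed

text \<open>After multiplication by \<open>A\<close> the quadratic is a square minus
  \<open>B\<^sup>2 - A * D\<close>. Its roots are mirror images in \<open>- B / A\<close>, so a
  single root must lie there.\<close>

lemma quadratic_unique_root_iff:
  fixes A B D :: real
  assumes "A > 0"
  shows "(\<exists>!t. A * t\<^sup>2 + 2 * B * t + D = 0) \<longleftrightarrow> B\<^sup>2 = A * D"
proof -
  have eq: "A * t\<^sup>2 + 2 * B * t + D = 0 \<longleftrightarrow> (A * t + B)\<^sup>2 = B\<^sup>2 - A * D" for t
  proof -
    have "A * (A * t\<^sup>2 + 2 * B * t + D) = (A * t + B)\<^sup>2 - (B\<^sup>2 - A * D)" by algebra
    then show ?thesis using assms by (metis eq_iff_diff_eq_0 mult_eq_0_iff less_irrefl)
  qed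
  show ?thesis
  proof
    assume "\<exists>!t. A * t\<^sup>2 + 2 * B * t + D = 0"
    then obtain t where t: "(A * t + B)\<^sup>2 = B\<^sup>2 - A * D"
      and uniq: "\<And>s. (A * s + B)\<^sup>2 = B\<^sup>2 - A * D \<Longrightarrow> s = t"
      unfolding eq by blast
    have "A * (- t - 2 * B / A) + B = - (A * t + B)" using assms by (simp add: field_simps)
    then have "(A * (- t - 2 * B / A) + B)\<^sup>2 = B\<^sup>2 - A * D"
      using t by (metis power2_minus)
    then have "- t - 2 * B / A = t" by (rule uniq)
    then have "A * t + B = 0" using assms by (simp add: field_simps)
    then show "B\<^sup>2 = A * D" using t by simp
  next
    assume "B\<^sup>2 = A * D"
    then show "\<exists>!t. A * t\<^sup>2 + 2 * B * t + D = 0"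
      unfolding eq using assms by (intro ex1I[of _ "- B / A"]) (auto simp: field_simps)
  qed
qed

text \<open>Along the line, membership in the circle is a quadratic equation in the parameter, and
  tangency means that it has one root. By Lagrange's identity, \<open>Re\<close> squared plus
  \<open>Im\<close> squared being the product of the squared norms, the vanishing discriminant says
  that the distance from \<open>C\<close> to the line is \<open>r\<close>.\<close>

lemma tangent_to_circle_line_iff:
  assumes "P \<noteq> Q" "r \<ge> 0"
  shows "tangent_to_circle (affine hull {P, Q}) C r \<longleftrightarrow>
    (Im (cnj (Q - P) * (C - P)))\<^sup>2 = r\<^sup>2 * (norm (Q - P))\<^sup>2"
proof -
  define D where "D = Q - P"
  define A where "A = (norm D)\<^sup>2"
  define B where "B = - Re (cnj D * (C - P))"
  define E where "E = (norm (C - P))\<^sup>2 - r\<^sup>2"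
  define f where "f = (\<lambda>t. P + t *\<^sub>R D)"
  have A: "A > 0" using assms by (simp add: A_def D_def)
  have "f t = f s \<Longrightarrow> t = s" for t s
    using assms by (simp add: f_def D_def)
  then have inj: "inj f" by (auto intro: injI)
  have line: "affine hull {P, Q} = range f"
    unfolding affine_hull_2_alt f_def D_def ..
  have sph: "f t \<in> sphere C r \<longleftrightarrow> A * t\<^sup>2 + 2 * B * t + E = 0" for t
  proof -
    have "(dist C (f t))\<^sup>2 - r\<^sup>2 = A * t\<^sup>2 + 2 * B * t + E"
      by (simp add: dist_norm A_def B_def E_def f_def cmod_power2) algebra
    moreover have "dist C (f t) = r \<longleftrightarrow> (dist C (f t))\<^sup>2 = r\<^sup>2"
      using assms(2) by (simp add: power2_eq_iff_nonneg)
    ultimately show ?thesis unfolding mem_sphere by linarith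
  qed
  have "tangent_to_circle (affine hull {P, Q}) C r \<longleftrightarrow> (\<exists>!t. f t \<in> sphere C r)"
  proof
    assume "tangent_to_circle (affine hull {P, Q}) C r"
    then obtain T where T: "range f \<inter> sphere C r = {T}"
      unfolding tangent_to_circle_def line by blast
    then obtain t where "T = f t" by blast
    with T show "\<exists>!t. f t \<in> sphere C r"
      using inj by (intro ex1I[of _ t]) (auto dest: injD)
  next
    assume "\<exists>!t. f t \<in> sphere C r"
    then obtain t where t: "f t \<in> sphere C r" "\<And>s. f s \<in> sphere C r \<Longrightarrow> s = t" by blast
    then have "range f \<inter> sphere C r = {f t}" by blast
    then show "tangent_to_circle (affine hull {P, Q}) C r"
      unfolding tangent_to_circle_def line by blast
  qed
  also have "\<dots> \<longleftrightarrow> B\<^sup>2 = A * E"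
    unfolding sph by (rule quadratic_unique_root_iff[OF A])
  also have "\<dots> \<longleftrightarrow> (Im (cnj (Q - P) * (C - P)))\<^sup>2 = r\<^sup>2 * (norm (Q - P))\<^sup>2"
  proof -
    have "B\<^sup>2 - A * E = r\<^sup>2 * (norm (Q - P))\<^sup>2 - (Im (cnj (Q - P) * (C - P)))\<^sup>2"
      unfolding A_def B_def E_def D_def cmod_power2 by (simp add: cmod_power2) algebra
    then show ?thesis by auto
  qed
  finally show ?thesis .
qed

section \<open>Semi-axes of an ellipse in arbitrary position\<close>

text \<open>Distances from a center range between \<open>q\<close> and \<open>p\<close>, and
  \<open>p\<close> is attained at two opposite points. The parallelogram law for these points, seen
  from the other center, gives \<open>(norm (z' - z))\<^sup>2 + p\<^sup>2 \<le> p'\<^sup>2\<close>.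
  By symmetry the centers and major semi-axes agree, and \<open>q\<close> is then the least distance
  from the common center.\<close>

lemma is_ellipse_with_semi_axes_unique:
  assumes "is_ellipse_with_semi_axes S p q" "is_ellipse_with_semi_axes S p' q'"
  shows "p = p' \<and> q = q'"
proof -
  have bounds: "\<exists>z. (\<forall>x\<in>S. q \<le> dist z x \<and> dist z x \<le> p) \<and>
      (\<exists>e. z + e \<in> S \<and> z - e \<in> S \<and> norm e = p) \<and> (\<exists>x\<in>S. dist z x = q)"
    if "is_ellipse_with_semi_axes S p q" for p q
  proof -
    from that obtain z \<phi> where pq: "q > 0" "p \<ge> q" and S: "S = (\<lambda>x. z + cis \<phi> * x) ` axis_ellipse p q"
      unfolding is_ellipse_with_semi_axes_def by blast
    have "q \<le> norm x \<and> norm x \<le> p" if "x \<in> axis_ellipse p q" for x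
    proof -
      have e: "(Re x / p)\<^sup>2 + (Im x / q)\<^sup>2 = 1" using that by (simp add: axis_ellipse_def)
      have "Re x = p * (Re x / p)" "Im x = q * (Im x / q)" using pq by simp_all
      then have n: "(norm x)\<^sup>2 = p\<^sup>2 * (Re x / p)\<^sup>2 + q\<^sup>2 * (Im x / q)\<^sup>2"
        by (metis cmod_power2 power_mult_distrib)
      have le: "q\<^sup>2 \<le> p\<^sup>2" using pq by (simp add: power_mono)
      have "p\<^sup>2 * (Re x / p)\<^sup>2 + q\<^sup>2 * (Im x / q)\<^sup>2 \<le> p\<^sup>2 * (Re x / p)\<^sup>2 + p\<^sup>2 * (Im x / q)\<^sup>2"
        by (intro add_left_mono mult_right_mono le) simp
      moreover have "q\<^sup>2 * (Re x / p)\<^sup>2 + q\<^sup>2 * (Im x / q)\<^sup>2 \<le> p\<^sup>2 * (Re x / p)\<^sup>2 + q\<^sup>2 * (Im x / q)\<^sup>2"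
        by (intro add_right_mono mult_right_mono le) simp
      ultimately have "(norm x)\<^sup>2 \<le> p\<^sup>2" "q\<^sup>2 \<le> (norm x)\<^sup>2"
        using e n by (simp_all flip: distrib_left)
      then show ?thesis using pq by (auto intro: power2_le_imp_le)
    qed
    then have 1: "\<forall>x\<in>S. q \<le> dist z x \<and> dist z x \<le> p"
      by (auto simp: S dist_norm norm_mult)
    have "of_real p \<in> axis_ellipse p q" "- of_real p \<in> axis_ellipse p q" "\<i> * of_real q \<in> axis_ellipse p q"
      using pq by (simp_all add: axis_ellipse_def)
    then have 2: "z + cis \<phi> * p \<in> S" "z + cis \<phi> * (- of_real p) \<in> S" "z + cis \<phi> * (\<i> * q) \<in> S"
      unfolding S by (simp_all only: image_eqI)
    have "norm (cis \<phi> * p) = p" "norm (cis \<phi> * (\<i> * q)) = q"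
      using pq by (simp_all add: norm_mult)
    then have "\<exists>e. z + e \<in> S \<and> z - e \<in> S \<and> norm e = p"
      using 2(1,2) by (intro exI[of _ "cis \<phi> * p"]) simp
    moreover have "\<exists>x\<in>S. dist z x = q"
      using 2(3) pq by (intro bexI[of _ "z + cis \<phi> * (\<i> * q)"]) (simp_all add: dist_norm norm_mult)
    ultimately have "\<exists>e. z + e \<in> S \<and> z - e \<in> S \<and> norm e = p" "\<exists>x\<in>S. dist z x = q"
      by blast+
    with 1 show ?thesis by blast
  qed
  obtain z e where z: "\<forall>x\<in>S. q \<le> dist z x \<and> dist z x \<le> p" "z + e \<in> S" "z - e \<in> S" "norm e = p"
    "\<exists>x\<in>S. dist z x = q"
    using bounds[OF assms(1)] by blast
  obtain z' e' where z': "\<forall>x\<in>S. q' \<le> dist z' x \<and> dist z' x \<le> p'" "z' + e' \<in> S" "z' - e' \<in> S"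
    "norm e' = p'" "\<exists>x\<in>S. dist z' x = q'"
    using bounds[OF assms(2)] by blast
  have par: "(norm (y - (x + f)))\<^sup>2 + (norm (y - (x - f)))\<^sup>2 = 2 * (norm (y - x))\<^sup>2 + 2 * (norm f)\<^sup>2"
    for x y f :: complex
    by (simp add: cmod_power2) algebra
  have sq: "(norm (y - x))\<^sup>2 \<le> k\<^sup>2" if "dist y x \<le> k" for x y :: complex and k
    using that by (simp add: dist_norm power_mono)
  have 1: "2 * (norm (z' - z))\<^sup>2 + 2 * p\<^sup>2 \<le> 2 * p'\<^sup>2"
    using par[of z' z e] sq[of z' "z + e" p'] sq[of z' "z - e" p'] z z' by simp
  have 2: "2 * (norm (z - z'))\<^sup>2 + 2 * p'\<^sup>2 \<le> 2 * p\<^sup>2"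
    using par[of z z' e'] sq[of z "z' + e'" p] sq[of z "z' - e'" p] z z' by simp
  have "(norm (z' - z))\<^sup>2 = 0" "p\<^sup>2 = p'\<^sup>2"
    using 1 2 zero_le_power2[of "norm (z' - z)"] zero_le_power2[of "norm (z - z')"] by linarith+
  moreover have "p \<ge> 0" "p' \<ge> 0" using z(4) z'(4) by auto
  ultimately have "z = z'" "p = p'" by (auto simp: power2_eq_iff_nonneg)
  moreover have "q = q'" using z z' \<open>z = z'\<close> by (metis order_antisym)
  ultimately show ?thesis by simp
qed

text \<open>Rotating by the mean \<phi> of the two arguments and shifting the parameter by half
  their difference \<psi> makes both coefficients real and nonnegative. Their sum then multiplies
  the cosine and their difference the sine.\<close>

lemma is_ellipse_image_sphere:
  fixes z A B :: complex
  assumes "norm B < norm A"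
  shows "is_ellipse_with_semi_axes ((\<lambda>w. z + A * w + B * cnj w) ` sphere 0 1)
    (norm A + norm B) (norm A - norm B)"
proof -
  define \<phi> where "\<phi> = (Arg A + Arg B) / 2"
  define \<psi> where "\<psi> = (Arg A - Arg B) / 2"
  define p where "p = norm A + norm B"
  define q where "q = norm A - norm B"
  have pq: "q > 0" "p > 0" "p \<ge> q" using assms norm_ge_zero[of B] unfolding p_def q_def by linarith+
  have "\<phi> + \<psi> = Arg A" "\<phi> - \<psi> = Arg B"
    by (simp_all add: \<phi>_def \<psi>_def field_simps)
  then have AB: "A = norm A * cis (\<phi> + \<psi>)" "B = norm B * cis (\<phi> - \<psi>)"
    by (simp_all add: rcis_cmod_Arg[unfolded rcis_def])
  have param: "z + A * cis \<theta> + B * cnj (cis \<theta>) =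
      z + cis \<phi> * Complex (p * cos (\<psi> + \<theta>)) (q * sin (\<psi> + \<theta>))" for \<theta>
  proof -
    have "A * cis \<theta> = cis \<phi> * (norm A * cis (\<psi> + \<theta>))"
      by (subst AB) (simp add: cis_mult algebra_simps)
    moreover have "B * cnj (cis \<theta>) = cis \<phi> * (norm B * cnj (cis (\<psi> + \<theta>)))"
      by (subst AB) (simp add: cis_mult cis_cnj algebra_simps)
    moreover have "norm A * cis (\<psi> + \<theta>) + norm B * cnj (cis (\<psi> + \<theta>)) =
        Complex (p * cos (\<psi> + \<theta>)) (q * sin (\<psi> + \<theta>))"
      by (simp add: complex_eq_iff p_def q_def algebra_simps)
    ultimately show ?thesis by (simp add: distrib_left[symmetric] add.assoc)
  qed
  have "(\<lambda>w. z + A * w + B * cnj w) ` sphere 0 1 = (\<lambda>w. z + cis \<phi> * w) ` axis_ellipse p q"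
    (is "?L = ?R")
  proof
    show "?L \<subseteq> ?R"
    proof
      fix x assume "x \<in> ?L"
      then obtain w where w: "norm w = 1" "x = z + A * w + B * cnj w" by auto
      then have "w = cis (Arg w)" using rcis_cmod_Arg[of w] by (simp add: rcis_def)
      then have x: "x = z + cis \<phi> * Complex (p * cos (\<psi> + Arg w)) (q * sin (\<psi> + Arg w))"
        using param[of "Arg w"] w(2) by metis
      have "Complex (p * cos (\<psi> + Arg w)) (q * sin (\<psi> + Arg w)) \<in> axis_ellipse p q"
        using pq by (simp add: axis_ellipse_def)
      then show "x \<in> ?R" using x by blast
    qed
    show "?R \<subseteq> ?L"
    proof
      fix x assume "x \<in> ?R"
      then obtain w where w: "(Re w / p)\<^sup>2 + (Im w / q)\<^sup>2 = 1" "x = z + cis \<phi> * w"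
        by (auto simp: axis_ellipse_def)
      obtain t where t: "Re w / p = cos t" "Im w / q = sin t"
        using sincos_total_2pi[OF w(1)] by metis
      then have "w = Complex (p * cos t) (q * sin t)"
        using pq by (simp add: complex_eq_iff field_simps)
      then have "x = z + A * cis (t - \<psi>) + B * cnj (cis (t - \<psi>))"
        using param[of "t - \<psi>"] w(2) by simp
      then show "x \<in> ?L" by (intro image_eqI[of _ _ "cis (t - \<psi>)"]) auto
    qed
  qed
  then show ?thesis unfolding is_ellipse_with_semi_axes_def p_def[symmetric] q_def[symmetric]
    using pq by blast
qed

section \<open>Tangent chords as a symmetric correspondence on the unit circle\<close>

text \<open>This map is real-linear only: it preserves lines but not distances, so tangency has to
  be rewritten in the normalized plane.\<close>

definition stretch :: "real \<Rightarrow> real \<Rightarrow> complex \<Rightarrow> complex" where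
  "stretch a b z = Complex (a * Re z) (b * Im z)"

lemma cnj_unit: "norm u = 1 \<Longrightarrow> u * cnj u = 1"
  by (metis complex_norm_square mult_1 of_real_1 power_one)

text \<open>Conjugation inverts unit numbers. This form removes conjugated chords from the equations
  below.\<close>

lemma cnj_diff_unit:
  assumes "norm u = 1" "norm v = 1"
  shows "u * v * cnj (v - u) = - (v - u)"
proof -
  have "u * v * cnj (v - u) = u * (v * cnj v) - v * (u * cnj u)" by (simp add: algebra_simps)
  then show ?thesis using assms by (simp add: cnj_unit)
qed

lemma norm_stretch_sq:
  "2 * (norm (stretch a b z))\<^sup>2 = (a\<^sup>2 + b\<^sup>2) * (norm z)\<^sup>2 + (a\<^sup>2 - b\<^sup>2) * Re (z\<^sup>2)"
  unfolding cmod_power2 Re_power2 by (simp add: stretch_def power_mult_distrib algebra_simps)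

text \<open>Since \<open>cnj u\<close> and \<open>cnj v\<close> are inverses, the distance equation
  becomes polynomial in \<open>u\<close> and \<open>v\<close> once
  \<open>(norm (v - u))\<^sup>2\<close> is cancelled. The normalized circle is an ellipse with
  semi-axes \<open>r / a\<close> and \<open>r / b\<close>, so
  \<open>(r * c / (a * b))\<^sup>2\<close> is the square of half its focal distance.\<close>

lemma tangent_chord_iff:
  fixes a b c r :: real and u v z :: complex
  assumes ab: "a > 0" "b > 0" and c: "c\<^sup>2 = a\<^sup>2 - b\<^sup>2" "c \<noteq> 0"
    and uv: "norm u = 1" "norm v = 1" "u \<noteq> v"
  shows "(Im (cnj (stretch a b v - stretch a b u) * (stretch a b z - stretch a b u)))\<^sup>2 =
      r\<^sup>2 * (norm (stretch a b v - stretch a b u))\<^sup>2 \<longleftrightarrow>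
    (z + cnj z * (u * v) - u - v)\<^sup>2 =
      of_real ((r * c / (a * b))\<^sup>2) * (2 * of_real ((a\<^sup>2 + b\<^sup>2) / c\<^sup>2) * (u * v) - 1 - (u * v)\<^sup>2)"
    (is "?l = ?r \<longleftrightarrow> ?L = ?R")
proof -
  define d where "d = v - u"
  define n where "n = (norm d)\<^sup>2"
  have n: "n > 0" using uv(3) by (simp add: n_def d_def)
  have uv0: "u * v \<noteq> 0" using uv by auto
  have uc: "u * cnj u = 1" "v * cnj v = 1" using uv cnj_unit by auto
  have dd: "u * v * cnj d = - d" unfolding d_def by (rule cnj_diff_unit[OF uv(1,2)])
  have nn: "of_real n = d * cnj d" unfolding n_def complex_norm_square ..
  \<comment> \<open>The square of a chord is a negative real multiple of \<open>u * v\<close>; hence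
    both sides of the tangency equation acquire the factor \<open>n\<close>.\<close>
  have d2: "d\<^sup>2 = - of_real n * (u * v)"
  proof -
    have "d\<^sup>2 = d * (- (u * v * cnj d))" by (simp add: dd power2_eq_square)
    then show ?thesis by (simp add: nn)
  qed
  have l: "?l = (a * b)\<^sup>2 * (Im (cnj d * (z - u)))\<^sup>2"
    by (simp add: stretch_def d_def power2_eq_square algebra_simps)
  have imc: "of_real (Im (cnj d * (z - u))) * (2 * \<i>) = cnj d * (z - u) - d * cnj (z - u)"
    by (simp add: complex_eq_iff algebra_simps)
  have "u * v * (cnj d * (z - u) - d * cnj (z - u)) = - d * (z + cnj z * (u * v) - u - v)"
  proof -
    have "u * v * (cnj d * (z - u) - d * cnj (z - u)) =
        (u * v * cnj d) * (z - u) - d * (cnj z * (u * v) - v * (u * cnj u))"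
      by (simp add: algebra_simps)
    also have "\<dots> = - d * (z + cnj z * (u * v) - u - v)"
      unfolding dd uc by (simp add: algebra_simps)
    finally show ?thesis .
  qed
  then have "(u * v * (of_real (Im (cnj d * (z - u))) * (2 * \<i>)))\<^sup>2 =
      d\<^sup>2 * (z + cnj z * (u * v) - u - v)\<^sup>2"
    unfolding imc by (simp add: power_mult_distrib)
  then have "(u * v) * (4 * of_real ((Im (cnj d * (z - u)))\<^sup>2) * (u * v)) = (u * v) * (of_real n * ?L)"
    unfolding d2 power_mult_distrib by (simp add: power2_eq_square algebra_simps)
  then have 1: "4 * of_real ((Im (cnj d * (z - u)))\<^sup>2) * (u * v) = of_real n * ?L"
    using uv0 by simp
  have "stretch a b v - stretch a b u = stretch a b d"
    by (simp add: stretch_def d_def complex_eq_iff algebra_simps)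
  then have r: "2 * ?r = r\<^sup>2 * ((a\<^sup>2 + b\<^sup>2) * n + c\<^sup>2 * Re (d\<^sup>2))"
    using norm_stretch_sq[of a b d] c(1) by (simp add: n_def)
  have uv1: "(u * v) * cnj (u * v) = 1" using cnj_unit[of "u * v"] uv by (simp add: norm_mult)
  have "2 * of_real (Re (d\<^sup>2)) * (u * v) = - of_real n * (1 + (u * v)\<^sup>2)"
  proof -
    have "2 * of_real (Re (d\<^sup>2)) = d\<^sup>2 + cnj (d\<^sup>2)"
      unfolding complex_add_cnj by simp
    also have "\<dots> = - of_real n * (u * v + cnj (u * v))"
      unfolding d2 by (simp add: algebra_simps)
    also have "\<dots> * (u * v) = - of_real n * ((u * v)\<^sup>2 + (u * v) * cnj (u * v))"
      by (simp add: algebra_simps power2_eq_square)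
    finally show ?thesis unfolding uv1 by (simp add: algebra_simps)
  qed
  then have 2: "of_real (4 * ?r) * (u * v) =
      of_real (r\<^sup>2 * n) * (2 * of_real (a\<^sup>2 + b\<^sup>2) * (u * v) - of_real (c\<^sup>2) * (1 + (u * v)\<^sup>2))"
  proof -
    assume h: "2 * of_real (Re (d\<^sup>2)) * (u * v) = - of_real n * (1 + (u * v)\<^sup>2)"
    have "4 * ?r = 2 * (r\<^sup>2 * ((a\<^sup>2 + b\<^sup>2) * n + c\<^sup>2 * Re (d\<^sup>2)))" unfolding r[symmetric] by simp
    then have "of_real (4 * ?r) * (u * v) = of_real (r\<^sup>2) * (2 * of_real (a\<^sup>2 + b\<^sup>2) * of_real n * (u * v) +
        of_real (c\<^sup>2) * (2 * of_real (Re (d\<^sup>2)) * (u * v)))"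
      by (simp add: algebra_simps)
    then show ?thesis unfolding h by (simp add: algebra_simps)
  qed
  have cr: "of_real (c\<^sup>2) * ?R * of_real ((a * b)\<^sup>2) =
      of_real (r\<^sup>2) * of_real (c\<^sup>2) * (2 * of_real (a\<^sup>2 + b\<^sup>2) * (u * v) - of_real (c\<^sup>2) * (1 + (u * v)\<^sup>2))"
  proof -
    have "k * (R * k / e * (2 * (s / k) * x - 1 - x\<^sup>2)) * e = R * k * (2 * s * x - k * (1 + x\<^sup>2))"
      if "k \<noteq> 0" "e \<noteq> 0" for k e R s x :: complex
      using that by (simp add: field_simps)
    from this[of "of_real (c\<^sup>2)" "of_real ((a * b)\<^sup>2)" "of_real (r\<^sup>2)" "of_real (a\<^sup>2 + b\<^sup>2)" "u * v"]
    show ?thesis using ab c(2)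
      by (simp only: power_divide power_mult_distrib[of r c] of_real_divide of_real_mult of_real_eq_0_iff
          power_eq_0_iff mult_eq_0_iff) simp
  qed
  \<comment> \<open>Multiplying by \<open>4 * u * v\<close> exposes the common nonzero factor
    \<open>n * (a * b)\<^sup>2\<close>, which is cancelled at the end.\<close>
  have "?l = ?r \<longleftrightarrow> of_real (4 * ?l) * (u * v) = of_real (4 * ?r) * (u * v)"
    using uv0 by (simp only: mult_cancel_right of_real_eq_iff) simp
  also have "of_real (4 * ?l) * (u * v) = of_real n * (of_real ((a * b)\<^sup>2) * ?L)"
    unfolding l using 1 by (simp add: algebra_simps)
  also have "of_real (4 * ?r) * (u * v) = of_real n * (of_real ((a * b)\<^sup>2) * ?R)"
  proof -
    have "of_real (c\<^sup>2) * (of_real ((a * b)\<^sup>2) * ?R) = of_real (c\<^sup>2) *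
        (of_real (r\<^sup>2) * (2 * of_real (a\<^sup>2 + b\<^sup>2) * (u * v) - of_real (c\<^sup>2) * (1 + (u * v)\<^sup>2)))"
      using cr by (simp only: mult_ac)
    then have "of_real ((a * b)\<^sup>2) * ?R =
        of_real (r\<^sup>2) * (2 * of_real (a\<^sup>2 + b\<^sup>2) * (u * v) - of_real (c\<^sup>2) * (1 + (u * v)\<^sup>2))"
      using c(2) by (simp only: mult_cancel_left) simp
    then show ?thesis using 2 by (simp only: of_real_mult mult_ac)
  qed
  also have "of_real n * (of_real ((a * b)\<^sup>2) * ?L) = of_real n * (of_real ((a * b)\<^sup>2) * ?R) \<longleftrightarrow> ?L = ?R"
    using n ab by (simp only: mult_cancel_left) simp
  finally show ?thesis .
qed

section \<open>Closure after three steps in terms of elementary symmetric functions\<close>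

text \<open>For fixed \<open>u\<close> the relation is quadratic in the other endpoint and has the
  roots \<open>v\<close> and \<open>w\<close>, so Vieta gives their product and sum. The products
  yield the symmetric functions, the sum yields Cayley's condition. The variables \<open>z'\<close>
  and \<open>m'\<close> stand for the conjugates of \<open>z\<close> and \<open>m\<close>, kept
  independent so that every identity is polynomial.\<close>

lemma chord_relation_imp_vieta:
  fixes u v w z z' m m' H K :: complex
  assumes "u \<noteq> v" "v \<noteq> w" "w \<noteq> u" "u \<noteq> 0" "v \<noteq> 0" "w \<noteq> 0"
  assumes m: "m = z\<^sup>2 + H" and m': "m' = z'\<^sup>2 + H"
  assumes uv: "(z + z' * (u * v) - u - v)\<^sup>2 = H * (2 * K * (u * v) - 1 - (u * v)\<^sup>2)"
    and vw: "(z + z' * (v * w) - v - w)\<^sup>2 = H * (2 * K * (v * w) - 1 - (v * w)\<^sup>2)"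
    and wu: "(z + z' * (w * u) - w - u)\<^sup>2 = H * (2 * K * (w * u) - 1 - (w * u)\<^sup>2)"
  shows "u + v + w = 2 * z + m' * (u * v * w)"
    "u * v + v * w + w * u = m + 2 * z' * (u * v * w)"
    "1 - 2 * (z * z') + m * m' = 2 * K * H"
proof -
  define \<beta> where "\<beta> = (\<lambda>u. 2 * (z - u) * (z' * u - 1) - 2 * K * H * u)"
  have Q: "(1 - 2 * z' * u + m' * u\<^sup>2) * v\<^sup>2 + \<beta> u * v + (u\<^sup>2 - 2 * z * u + m) = 0"
    if "(z + z' * (u * v) - u - v)\<^sup>2 = H * (2 * K * (u * v) - 1 - (u * v)\<^sup>2)" for u v
    using that unfolding m m' \<beta>_def by algebra
  have viet: "u\<^sup>2 - 2 * z * u + m = (1 - 2 * z' * u + m' * u\<^sup>2) * (v * w)"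
    "\<beta> u = - (1 - 2 * z' * u + m' * u\<^sup>2) * (v + w)"
    if "(z + z' * (u * v) - u - v)\<^sup>2 = H * (2 * K * (u * v) - 1 - (u * v)\<^sup>2)"
      "(z + z' * (w * u) - w - u)\<^sup>2 = H * (2 * K * (w * u) - 1 - (w * u)\<^sup>2)" "v \<noteq> w" for u v w
  proof -
    have a: "(1 - 2 * z' * u + m' * u\<^sup>2) * v\<^sup>2 + \<beta> u * v + (u\<^sup>2 - 2 * z * u + m) = 0"
      by (rule Q[OF that(1)])
    have b: "(1 - 2 * z' * u + m' * u\<^sup>2) * w\<^sup>2 + \<beta> u * w + (u\<^sup>2 - 2 * z * u + m) = 0"
      by (rule Q) (use that(2) in algebra)
    have "(v - w) * ((1 - 2 * z' * u + m' * u\<^sup>2) * (v + w) + \<beta> u) = 0"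
      using a b by algebra
    then have 1: "(1 - 2 * z' * u + m' * u\<^sup>2) * (v + w) + \<beta> u = 0" using that(3) by simp
    then show "\<beta> u = - (1 - 2 * z' * u + m' * u\<^sup>2) * (v + w)" by algebra
    show "u\<^sup>2 - 2 * z * u + m = (1 - 2 * z' * u + m' * u\<^sup>2) * (v * w)" using 1 a by algebra
  qed
  define p where "p = u + v + w - 2 * z - m' * (u * v * w)"
  define q where "q = u * v + v * w + w * u - m - 2 * z' * (u * v * w)"
  \<comment> \<open>Multiplied by \<open>u\<close>, the product relation is a cubic equation for
    \<open>u\<close>. Comparison with \<open>(x - u) * (x - v) * (x - w)\<close> at
    \<open>x = u\<close> cancels the cubic and constant terms. The linear polynomial
    \<open>p * x - q\<close> left over vanishes at the distinct points \<open>u\<close> and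
    \<open>v\<close>, hence identically.\<close>
  have "u * (p * u - q) = 0"
    using viet(1)[OF uv wu assms(2)] unfolding p_def q_def by algebra
  then have 1: "p * u = q" using assms by simp
  have "v * (p * v - q) = 0"
    using viet(1)[OF vw uv assms(3)] unfolding p_def q_def by algebra
  then have 2: "p * v = q" using assms by simp
  have "p * (u - v) = 0" using 1 2 by (simp add: algebra_simps)
  then have "p = 0" using assms(1) by simp
  moreover have "q = 0" using 1 \<open>p = 0\<close> by simp
  ultimately show s1: "u + v + w = 2 * z + m' * (u * v * w)"
    and s2: "u * v + v * w + w * u = m + 2 * z' * (u * v * w)"
    by (simp_all add: p_def q_def algebra_simps)
  \<comment> \<open>The sum relation at \<open>u\<close> reduces to the closure condition once the
    symmetric functions are substituted.\<close>
  have "u * (1 - 2 * (z * z') + m * m' - 2 * K * H) = 0"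
    using viet(2)[OF uv wu assms(2)] s1 s2 unfolding \<beta>_def by algebra
  then show "1 - 2 * (z * z') + m * m' = 2 * K * H" using assms by simp
qed

text \<open>The symmetric functions determine \<open>v * w\<close>, and together with the closure
  condition also \<open>v + w\<close>, as the coefficients of the quadratic attached to
  \<open>u\<close>. So \<open>v\<close> is a root of it, which is the chord relation.\<close>

lemma vieta_imp_chord_relation:
  fixes u v w z z' m m' H K :: complex
  assumes "u \<noteq> 0"
  assumes m: "m = z\<^sup>2 + H" "m' = z'\<^sup>2 + H"
    and s: "u + v + w = 2 * z + m' * (u * v * w)"
    "u * v + v * w + w * u = m + 2 * z' * (u * v * w)"
    and K: "1 - 2 * (z * z') + m * m' = 2 * K * H"
  shows "(z + z' * (u * v) - u - v)\<^sup>2 = H * (2 * K * (u * v) - 1 - (u * v)\<^sup>2)"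
proof -
  have g: "u\<^sup>2 - 2 * z * u + m = (1 - 2 * z' * u + m' * u\<^sup>2) * (v * w)"
  proof -
    have "u * (u\<^sup>2 - 2 * z * u + m) = u * ((1 - 2 * z' * u + m' * u\<^sup>2) * (v * w))"
      using s by algebra
    then show ?thesis using assms(1) by simp
  qed
  have b: "2 * (z - u) * (z' * u - 1) - 2 * K * H * u = - (1 - 2 * z' * u + m' * u\<^sup>2) * (v + w)"
    using s K by algebra
  show ?thesis using g b m by algebra
qed

lemma monic_cubic_splits:
  fixes a b c :: complex
  obtains u v w where "u + v + w = a" "u * v + v * w + w * u = b" "u * v * w = c"
proof -
  have "\<exists>u. poly [:- c, b, - a, 1:] u = 0"
    by (rule alg_closed_imp_poly_has_root) simp
  then obtain u where u: "u^3 - a * u\<^sup>2 + b * u - c = 0"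
    by (auto simp: algebra_simps power2_eq_square power3_eq_cube)
  \<comment> \<open>This is the quotient of the cubic by \<open>x - u\<close>; the third root is
    then read off from the sum.\<close>
  have "\<exists>v. poly [:b - u * (a - u), - (a - u), 1:] v = 0"
    by (rule alg_closed_imp_poly_has_root) simp
  then obtain v where v: "v\<^sup>2 - (a - u) * v + (b - u * (a - u)) = 0"
    by (auto simp: algebra_simps power2_eq_square)
  show ?thesis
  proof (rule that[of u v "a - u - v"])
    show "u * v + v * (a - u - v) + (a - u - v) * u = b" using v by algebra
    show "u * v * (a - u - v) = c" using u v by algebra
  qed simp
qed

section \<open>Inscribed triangles in normalized coordinates\<close>

lemma stretch_surj:
  assumes "a \<noteq> 0" "b \<noteq> 0"
  obtains w where "P = stretch a b w"
  using assms that[of "Complex (Re P / a) (Im P / b)"] by (simp add: stretch_def)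

lemma stretch_inj: "a \<noteq> 0 \<Longrightarrow> b \<noteq> 0 \<Longrightarrow> stretch a b z = stretch a b w \<longleftrightarrow> z = w"
  by (auto simp: stretch_def complex_eq_iff)

lemma stretch_diff: "stretch a b z - stretch a b w = stretch a b (z - w)"
  by (simp add: stretch_def complex_eq_iff algebra_simps)

lemma stretch_in_axis_ellipse:
  "a \<noteq> 0 \<Longrightarrow> b \<noteq> 0 \<Longrightarrow> stretch a b w \<in> axis_ellipse a b \<longleftrightarrow> norm w = 1"
  by (simp add: stretch_def axis_ellipse_def cmod_def)

lemma stretch_in_axis_ellipse_interior:
  "a \<noteq> 0 \<Longrightarrow> b \<noteq> 0 \<Longrightarrow> stretch a b w \<in> axis_ellipse_interior a b \<longleftrightarrow> norm w < 1"
  by (simp add: stretch_def axis_ellipse_interior_def cmod_def)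

text \<open>Collinearity makes \<open>cnj (v - u) * (w - u)\<close> equal to its conjugate.
  Multiplied by \<open>u * v * w\<close>, this equation turns into the vanishing of a Vandermonde
  product.\<close>

lemma not_collinear_stretch_unit:
  assumes "a \<noteq> 0" "b \<noteq> 0" "norm u = 1" "norm v = 1" "norm w = 1" "u \<noteq> v" "v \<noteq> w" "w \<noteq> u"
  shows "\<not> collinear {stretch a b u, stretch a b v, stretch a b w}"
proof
  assume "collinear {stretch a b u, stretch a b v, stretch a b w}"
  then have "a * b * Im (cnj (v - u) * (w - u)) = 0"
    unfolding collinear_complex_iff stretch_diff by (simp add: stretch_def algebra_simps)
  then have "Im (cnj (v - u) * (w - u)) = 0" using assms by simp
  moreover have "x = cnj x" if "Im x = 0" for x using that by (simp add: complex_eq_iff)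
  ultimately have "cnj (v - u) * (w - u) = cnj (cnj (v - u) * (w - u))" by blast
  then have "(u * v * w) * (cnj (v - u) * (w - u)) = (u * v * w) * ((v - u) * cnj (w - u))"
    by simp
  then have "(u * v * cnj (v - u)) * w * (w - u) = (u * w * cnj (w - u)) * v * (v - u)"
    by (simp only: mult_ac)
  then have "(v - u) * (w - u) * (v - w) = 0"
    unfolding cnj_diff_unit[OF assms(3,4)] cnj_diff_unit[OF assms(3,5)] by algebra
  then show False using assms by simp
qed

text \<open>The squared distance from the given point to a vertex depends on \<open>u\<close>,
  \<open>v\<close>, \<open>w\<close> only through a symmetric expression. One computation therefore
  serves all three vertices by cyclic permutation.\<close>

lemma circumcenter_stretch_unit:
  fixes a b :: real
  assumes ab: "a \<noteq> 0" "b \<noteq> 0" and n: "norm u = 1" "norm v = 1" "norm w = 1"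
    and d: "u \<noteq> v" "v \<noteq> w" "w \<noteq> u"
  shows "circumcenter (stretch a b u) (stretch a b v) (stretch a b w) =
    Complex ((a\<^sup>2 - b\<^sup>2) / (4 * a) * Re (u + v + w + u * v * w))
      (- (a\<^sup>2 - b\<^sup>2) / (4 * b) * Im (u + v + w - u * v * w))" (is "_ = ?X")
proof (rule circumcenter_eqI)
  show "\<not> collinear {stretch a b u, stretch a b v, stretch a b w}"
    by (rule not_collinear_stretch_unit[OF ab n d])
  have key: "(dist ?X (stretch a b u))\<^sup>2 =
      (norm ?X)\<^sup>2 + (a\<^sup>2 + b\<^sup>2) / 2 - (a\<^sup>2 - b\<^sup>2) / 2 * Re (u * v + v * w + w * u)"
    if n: "norm u = 1" "norm v = 1" "norm w = 1"
      and X: "?X = Complex ((a\<^sup>2 - b\<^sup>2) / (4 * a) * Re (u + v + w + u * v * w))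
        (- (a\<^sup>2 - b\<^sup>2) / (4 * b) * Im (u + v + w - u * v * w))" for u v w
  proof -
    define X where "X = ?X"
    let ?s = "u + v + w" and ?p = "u * v * w"
    have 1: "(dist X (stretch a b u))\<^sup>2 = (norm X)\<^sup>2 + (norm (stretch a b u))\<^sup>2 -
        2 * (Re X * (a * Re u) + Im X * (b * Im u))"
      unfolding dist_norm cmod_power2 by (simp add: stretch_def power2_eq_square algebra_simps)
    have "Re X * (a * Re u) + Im X * (b * Im u) =
        (a\<^sup>2 - b\<^sup>2) / 4 * (Re (?s + ?p) * Re u - Im (?s - ?p) * Im u)"
      unfolding X_def X using ab by (simp add: field_simps)
    also have "Re (?s + ?p) * Re u - Im (?s - ?p) * Im u = Re (?s * u) + Re (?p * cnj u)"
      by (simp add: algebra_simps)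
    also have "?p * cnj u = v * w * (u * cnj u)" by simp
    also have "\<dots> = v * w" using cnj_unit[OF n(1)] by simp
    finally have 2: "Re X * (a * Re u) + Im X * (b * Im u) =
        (a\<^sup>2 - b\<^sup>2) / 4 * (Re (?s * u) + Re (v * w))" .
    have 3: "(norm (stretch a b u))\<^sup>2 = (a\<^sup>2 + b\<^sup>2) / 2 + (a\<^sup>2 - b\<^sup>2) / 2 * Re (u\<^sup>2)"
      using norm_stretch_sq[of a b u] n(1) by (simp add: field_simps)
    show ?thesis unfolding X_def[symmetric] 1 2 3 by (simp add: power2_eq_square field_simps)
  qed
  have sq: "dist ?X P = dist ?X Q" if "(dist ?X P)\<^sup>2 = (dist ?X Q)\<^sup>2" for P Q
    using that by (simp only: power2_eq_iff_nonneg[OF zero_le_dist zero_le_dist])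
  have ku: "(dist ?X (stretch a b u))\<^sup>2 =
      (norm ?X)\<^sup>2 + (a\<^sup>2 + b\<^sup>2) / 2 - (a\<^sup>2 - b\<^sup>2) / 2 * Re (u * v + v * w + w * u)"
    by (rule key[OF n refl])
  have kv: "(dist ?X (stretch a b v))\<^sup>2 =
      (norm ?X)\<^sup>2 + (a\<^sup>2 + b\<^sup>2) / 2 - (a\<^sup>2 - b\<^sup>2) / 2 * Re (v * w + w * u + u * v)"
    by (rule key[OF n(2,3,1)]) (simp add: ac_simps)
  have kw: "(dist ?X (stretch a b w))\<^sup>2 =
      (norm ?X)\<^sup>2 + (a\<^sup>2 + b\<^sup>2) / 2 - (a\<^sup>2 - b\<^sup>2) / 2 * Re (w * u + u * v + v * w)"
    by (rule key[OF n(3,1,2)]) (simp add: ac_simps)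
  show "dist ?X (stretch a b u) = dist ?X (stretch a b v)"
    by (rule sq, subst ku, subst kv) (simp only: ac_simps)
  show "dist ?X (stretch a b v) = dist ?X (stretch a b w)"
    by (rule sq, subst kv, subst kw) (simp only: ac_simps)
qed

section \<open>Foci in the disk, unimodular roots, nestedness and distinct vertices\<close>

text \<open>With \<open>F\<close> and \<open>G\<close> the squared norms of the foci, the closure
  condition reads \<open>(1 - F) * (1 - G) = 2 * (K - 1) * H > 0\<close>. So both are below 1 or
  both above, and \<open>F * G < 1\<close> excludes the latter.\<close>

lemma foci_in_unit_disk:
  fixes z m :: complex and h H K :: real
  assumes H: "H > 0" "h\<^sup>2 = H" and m: "m = z\<^sup>2 + of_real H" "norm m < 1"
    and K: "K > 1" "1 - 2 * (norm z)\<^sup>2 + (norm m)\<^sup>2 = 2 * K * H"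
  shows "norm (z + \<i> * h) < 1" "norm (z - \<i> * h) < 1" "(norm z)\<^sup>2 + H < 1"
proof -
  define F where "F = (norm (z + \<i> * h))\<^sup>2"
  define G where "G = (norm (z - \<i> * h))\<^sup>2"
  have FG: "F + G = 2 * (norm z)\<^sup>2 + 2 * H"
    unfolding F_def G_def cmod_power2 H(2)[symmetric] by (simp add: power2_eq_square algebra_simps)
  have "(z + \<i> * h) * (z - \<i> * h) = m"
    unfolding m(1) H(2)[symmetric] by (simp add: power2_eq_square algebra_simps)
  then have FG': "F * G = (norm m)\<^sup>2"
    unfolding F_def G_def by (metis norm_mult power_mult_distrib)
  have "(1 - F) * (1 - G) = 2 * (K - 1) * H"
    using FG FG' K(2) by (simp add: algebra_simps)
  then have pos: "(1 - F) * (1 - G) > 0" using K H by simp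
  have "F * G < 1" using FG' m(2) by (simp add: power_less_one_iff abs_square_less_1)
  have nn: "F \<ge> 0" "G \<ge> 0" by (simp_all add: F_def G_def)
  have "F < 1 \<and> G < 1"
  proof (rule ccontr)
    assume "\<not> (F < 1 \<and> G < 1)"
    then have "F > 1 \<and> G > 1" using pos by (auto simp: zero_less_mult_iff)
    then have "1 * 1 < F * G" by (intro mult_strict_mono) auto
    then show False using \<open>F * G < 1\<close> by simp
  qed
  then show "(norm z)\<^sup>2 + H < 1" using FG by linarith
  show "norm (z + \<i> * h) < 1" "norm (z - \<i> * h) < 1"
    using \<open>F < 1 \<and> G < 1\<close> by (simp_all add: F_def G_def abs_square_less_1)
qed

text \<open>If \<open>norm A < norm B\<close>, the negative difference of squares is
  \<open>norm B - norm A\<close> times a factor less than 2 in absolute value, and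
  \<open>norm (A + B)\<close> is at least \<open>norm B - norm A\<close>.\<close>

lemma norm_sq_diff_plus_norm_add_pos:
  fixes A B :: complex
  assumes "norm B < 1" "A + B \<noteq> 0"
  shows "(norm A)\<^sup>2 - (norm B)\<^sup>2 + 2 * norm (A + B) > 0"
proof (cases "norm A \<ge> norm B")
  case True
  then have "(norm A)\<^sup>2 - (norm B)\<^sup>2 \<ge> 0" by (simp add: power_mono)
  moreover have "norm (A + B) > 0" using assms by simp
  ultimately show ?thesis by linarith
next
  case False
  have "norm B - norm A \<le> norm (A + B)"
    using norm_diff_ineq[of B A] by (simp add: add.commute)
  moreover have "0 < (norm B - norm A) * (2 - norm A - norm B)" using False assms by simp
  then have "0 < (norm A)\<^sup>2 - (norm B)\<^sup>2 + 2 * (norm B - norm A)"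
    by (simp add: power2_eq_square algebra_simps)
  ultimately show ?thesis by argo
qed

text \<open>By the identity \<open>bl\<close>, each Blaschke factor has modulus below 1 inside the
  disk and above 1 outside. A product of three such factors, one of them \<open>x\<close>, can have
  modulus 1 only on the circle.\<close>

lemma unit_root:
  fixes f g x l :: complex
  assumes fg: "norm f < 1" "norm g < 1" and l: "norm l = 1"
    and x: "x * (x - f) * (x - g) = l * (1 - cnj f * x) * (1 - cnj g * x)"
  shows "norm x = 1"
proof -
  have bl: "(norm (1 - cnj f * x))\<^sup>2 - (norm (x - f))\<^sup>2 = (1 - (norm f)\<^sup>2) * (1 - (norm x)\<^sup>2)" for f
    unfolding cmod_power2 by (simp add: power2_eq_square algebra_simps)
  have nx: "norm x * norm (x - f) * norm (x - g) = norm (1 - cnj f * x) * norm (1 - cnj g * x)"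
    using arg_cong[OF x, of norm] l by (simp add: norm_mult)
  have sq: "1 - (norm f)\<^sup>2 > 0" if "norm f < 1" for f :: complex
    using that by (simp add: abs_square_less_1)
  show ?thesis
  proof (rule ccontr)
    assume "norm x \<noteq> 1"
    then consider "norm x < 1" | "norm x > 1" by linarith
    then show False
    proof cases
      case 1
      have lt: "norm (x - f) < norm (1 - cnj f * x)" if "norm f < 1" for f
      proof -
        have "(1 - (norm f)\<^sup>2) * (1 - (norm x)\<^sup>2) > 0"
          using sq[OF that] sq[OF 1] by simp
        then have "(norm (x - f))\<^sup>2 < (norm (1 - cnj f * x))\<^sup>2" using bl[of f] by linarith
        then show ?thesis by (rule power2_less_imp_less) simp
      qed
      have "norm x * (norm (x - f) * norm (x - g)) \<le> 1 * (norm (x - f) * norm (x - g))"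
        using 1 by (intro mult_right_mono) auto
      also have "\<dots> < norm (1 - cnj f * x) * norm (1 - cnj g * x)"
        using lt fg by (simp add: mult_strict_mono')
      finally show False using nx by (simp add: mult.assoc)
    next
      case 2
      have lt: "norm (1 - cnj f * x) < norm (x - f)" if "norm f < 1" for f
      proof -
        have "(norm x)\<^sup>2 > 1" using 2 by (simp add: one_less_power)
        then have "(1 - (norm f)\<^sup>2) * ((norm x)\<^sup>2 - 1) > 0"
          using sq[OF that] by simp
        then have "(norm (1 - cnj f * x))\<^sup>2 < (norm (x - f))\<^sup>2" using bl[of f]
          by (simp add: algebra_simps)
        then show ?thesis by (rule power2_less_imp_less) simp
      qed
      have "norm (1 - cnj f * x) * norm (1 - cnj g * x) < norm (x - f) * norm (x - g)"
        using lt fg by (simp add: mult_strict_mono')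
      also have "1 * (norm (x - f) * norm (x - g)) \<le> norm x * (norm (x - f) * norm (x - g))"
        using 2 by (intro mult_right_mono) auto
      finally show False using nx by (simp add: mult.assoc)
    qed
  qed
qed

lemma cball_subset_ellipse_interior:
  fixes a b r :: real
  assumes ab: "a > 0" "b > 0" and z: "norm z < 1"
    and far: "\<And>u. norm u = 1 \<Longrightarrow> r < dist (stretch a b z) (stretch a b u)"
  shows "cball (stretch a b z) r \<subseteq> axis_ellipse_interior a b"
proof
  fix p assume p: "p \<in> cball (stretch a b z) r"
  obtain y where y: "p = stretch a b y" using stretch_surj[of a b p] ab by auto
  have "norm y < 1"
  proof (rule ccontr)
    assume "\<not> norm y < 1"
    \<comment> \<open>The segment from the center to an outer point crosses the unit circle; the
      image of the crossing point lies within distance \<open>r\<close> of the center, against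
      \<open>far\<close>.\<close>
    have "\<exists>s\<ge>0. s \<le> 1 \<and> norm (z + s *\<^sub>R (y - z)) = 1"
      using z \<open>\<not> norm y < 1\<close> by (intro IVT') (auto intro!: continuous_intros)
    then obtain s where s: "0 \<le> s" "s \<le> 1" "norm (z + s *\<^sub>R (y - z)) = 1" by blast
    have "dist (stretch a b z) (stretch a b (z + s *\<^sub>R (y - z))) = norm (stretch a b (- s *\<^sub>R (y - z)))"
      unfolding dist_norm stretch_diff by simp
    also have "stretch a b (- s *\<^sub>R (y - z)) = s *\<^sub>R stretch a b (z - y)"
      by (simp add: stretch_def complex_eq_iff algebra_simps)
    also have "norm \<dots> = s * dist (stretch a b z) p"
      unfolding dist_norm y stretch_diff using s by simp
    also have "\<dots> \<le> 1 * r" using s p by (intro mult_mono) auto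
    finally show False using far[OF s(3)] by simp
  qed
  then show "p \<in> axis_ellipse_interior a b"
    unfolding y using ab by (simp add: stretch_in_axis_ellipse_interior)
qed

text \<open>The distances of \<open>u\<close> from the foci have product \<open>E\<close>, and their
  sum has square \<open>2 * (S + E)\<close>. The bound \<open>S + E > 2 * a\<^sup>2 * G\<close> says
  that this sum exceeds the major axis \<open>2 * r / b\<close> of the normalized circle, so
  \<open>u\<close> lies outside it.\<close>

lemma dist_ellipse_gt:
  fixes a b c r H :: real and z m u :: complex
  assumes ab: "b > 0" "a > b" and c: "c\<^sup>2 = a\<^sup>2 - b\<^sup>2"
    and H: "H = (r * c / (a * b))\<^sup>2" "H > 0" "r > 0"
    and m: "m = z\<^sup>2 + of_real H" "norm m < 1"
    and K: "1 - 2 * (norm z)\<^sup>2 + (norm m)\<^sup>2 = 2 * ((a\<^sup>2 + b\<^sup>2) / c\<^sup>2) * H"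
    and foci: "(u - z)\<^sup>2 + of_real H \<noteq> 0"
    and u: "norm u = 1"
  shows "r < dist (stretch a b z) (stretch a b u)"
proof -
  define w where "w = u - z"
  define S where "S = (norm w)\<^sup>2 + H"
  define E where "E = norm (w\<^sup>2 + of_real H)"
  have c0: "c\<^sup>2 > 0" using ab c by (simp add: power_strict_mono)
  define G where "G = H / c\<^sup>2"
  have G: "G > 0" "H = c\<^sup>2 * G" "r\<^sup>2 = a\<^sup>2 * b\<^sup>2 * G"
    using c0 H ab by (simp_all add: G_def power_divide power_mult_distrib)
  have uc: "u * cnj u = 1" by (rule cnj_unit[OF u])
  have "S + E > 2 * a\<^sup>2 * G"
  proof -
    define A where "A = 1 - 2 * z * cnj u"
    define B where "B = m * (cnj u)\<^sup>2"
    have nB: "norm B = norm m" using u by (simp add: B_def norm_mult norm_power)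
    have "u\<^sup>2 * (A + B) = u * u - 2 * z * u * (u * cnj u) + m * (u * cnj u)\<^sup>2"
      by (simp add: A_def B_def power2_eq_square algebra_simps)
    also have "\<dots> = w\<^sup>2 + of_real H"
      unfolding uc m(1) w_def by (simp add: power2_eq_square algebra_simps)
    finally have AB: "u\<^sup>2 * (A + B) = w\<^sup>2 + of_real H" .
    then have E: "norm (A + B) = E"
      unfolding E_def by (metis mult_1 norm_mult norm_power power_one u)
    have "A + B \<noteq> 0" using AB foci unfolding w_def by auto
    then have pos: "(norm A)\<^sup>2 - (norm m)\<^sup>2 + 2 * E > 0"
      using norm_sq_diff_plus_norm_add_pos[of B A] m(2) nB E by simp
    have un: "(Re u)\<^sup>2 + (Im u)\<^sup>2 = 1" using u cmod_power2[of u] by simp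
    \<comment> \<open>The parallelogram law for \<open>u - z\<close> and \<open>z\<close>, as
      \<open>norm A = norm (u - 2 * z)\<close>.\<close>
    have "(norm A)\<^sup>2 + 1 = 2 * (norm w)\<^sup>2 + 2 * (norm z)\<^sup>2"
      using un unfolding cmod_power2 A_def w_def by simp algebra
    then have "2 * (norm w)\<^sup>2 + 2 * E > 1 - 2 * (norm z)\<^sup>2 + (norm m)\<^sup>2"
      using pos by simp
    then have "2 * S + 2 * E > 2 * ((a\<^sup>2 + b\<^sup>2) / c\<^sup>2) * H + 2 * H"
      unfolding S_def K by simp
    also have "2 * ((a\<^sup>2 + b\<^sup>2) / c\<^sup>2) * H + 2 * H = 4 * a\<^sup>2 * G"
    proof -
      have "2 * ((a\<^sup>2 + b\<^sup>2) / c\<^sup>2) * H + 2 * H = 2 * (a\<^sup>2 + b\<^sup>2) * G + 2 * (c\<^sup>2 * G)"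
        unfolding G(2) using c0 by simp
      then show ?thesis unfolding c by (simp add: algebra_simps)
    qed
    finally show ?thesis by simp
  qed
  have d: "(dist (stretch a b z) (stretch a b u))\<^sup>2 = b\<^sup>2 * (norm w)\<^sup>2 + c\<^sup>2 * (Re w)\<^sup>2"
    unfolding dist_norm norm_minus_commute[of "stretch a b z"] stretch_diff w_def cmod_power2 c
    by (simp add: stretch_def power2_eq_square algebra_simps)
  have n: "(norm w)\<^sup>2 = (Re w)\<^sup>2 + (Im w)\<^sup>2" by (rule cmod_power2)
  have "r\<^sup>2 < (dist (stretch a b z) (stretch a b u))\<^sup>2"
  \<comment> \<open>The bound \<open>E > 2 * a\<^sup>2 * G - S\<close> can be squared only if the
    right-hand side is nonnegative; otherwise \<open>norm w\<close> alone is large enough.\<close>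
  proof (cases "S \<ge> 2 * a\<^sup>2 * G")
    case True
    have "2 * a\<^sup>2 * G - H = (a\<^sup>2 + b\<^sup>2) * G" unfolding G(2) c by (simp add: algebra_simps)
    then have "(norm w)\<^sup>2 \<ge> (a\<^sup>2 + b\<^sup>2) * G" using True by (simp add: S_def)
    then have "b\<^sup>2 * (norm w)\<^sup>2 \<ge> b\<^sup>2 * ((a\<^sup>2 + b\<^sup>2) * G)" by (intro mult_left_mono) auto
    moreover have "b\<^sup>2 * ((a\<^sup>2 + b\<^sup>2) * G) = r\<^sup>2 + b\<^sup>2 * b\<^sup>2 * G" unfolding G(3) by (simp add: algebra_simps)
    moreover have "b\<^sup>2 * b\<^sup>2 * G > 0" using ab G by simp
    moreover have "c\<^sup>2 * (Re w)\<^sup>2 \<ge> 0" by simp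
    ultimately show ?thesis unfolding d by linarith
  next
    case False
    have E2: "E\<^sup>2 = S\<^sup>2 - 4 * H * (Im w)\<^sup>2"
      unfolding E_def S_def cmod_power2 by (simp add: Re_power2 Im_power2) algebra
    have "(2 * a\<^sup>2 * G - S)\<^sup>2 < E\<^sup>2"
      using False \<open>S + E > 2 * a\<^sup>2 * G\<close> by (intro power_strict_mono) auto
    then have "4 * G * (a\<^sup>2 * (S - a\<^sup>2 * G) - c\<^sup>2 * (Im w)\<^sup>2) > 0"
      unfolding E2 unfolding G(2) by (simp add: power2_eq_square algebra_simps)
    then have "a\<^sup>2 * (S - a\<^sup>2 * G) - c\<^sup>2 * (Im w)\<^sup>2 > 0" using G by (simp add: zero_less_mult_iff)
    moreover have "a\<^sup>2 * (S - a\<^sup>2 * G) - c\<^sup>2 * (Im w)\<^sup>2 =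
        (dist (stretch a b z) (stretch a b u))\<^sup>2 - r\<^sup>2"
      unfolding d G(3) S_def G(2) n c by (simp add: algebra_simps)
    ultimately show ?thesis by linarith
  qed
  then show ?thesis by (rule power2_less_imp_less) simp
qed

text \<open>A double root would make the tangent of the ellipse at \<open>stretch a b u\<close> touch the circle,
  at a point that lies in the interior of the ellipse.\<close>

lemma no_double_root:
  fixes a b c r H :: real and z u :: complex
  assumes ab: "a > 0" "b > 0" and c: "c\<^sup>2 = a\<^sup>2 - b\<^sup>2" "c \<noteq> 0" and r: "r > 0"
    and H: "H = (r * c / (a * b))\<^sup>2"
    and nested: "cball (stretch a b z) r \<subseteq> axis_ellipse_interior a b"
    and u: "norm u = 1"
  shows "(z + cnj z * (u * u) - u - u)\<^sup>2 \<noteq>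
    of_real H * (2 * of_real ((a\<^sup>2 + b\<^sup>2) / c\<^sup>2) * (u * u) - 1 - (u * u)\<^sup>2)"
proof
  assume eq: "(z + cnj z * (u * u) - u - u)\<^sup>2 =
    of_real H * (2 * of_real ((a\<^sup>2 + b\<^sup>2) / c\<^sup>2) * (u * u) - 1 - (u * u)\<^sup>2)"
  define \<rho> where "\<rho> = Re (z * cnj u)"
  \<comment> \<open>A normal vector of the ellipse at \<open>stretch a b u\<close>. The distance
    from \<open>stretch a b z\<close> to the tangent there is
    \<open>\<bar>1 - \<rho>\<bar> / norm n\<close>.\<close>
  define n where "n = Complex (Re u / a) (Im u / b)"
  have uc: "u * cnj u = 1" by (rule cnj_unit[OF u])
  have zr: "z * cnj u + cnj z * u = of_real (2 * \<rho>)"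
    by (simp add: \<rho>_def complex_eq_iff algebra_simps)
  have u2: "of_real (2 * Re (u\<^sup>2)) = u\<^sup>2 + (cnj u)\<^sup>2"
    using complex_add_cnj[of "u\<^sup>2"] by simp
  have "z + cnj z * (u * u) - u - u = u * (z * cnj u + cnj z * u - 2) + z * (1 - u * cnj u)"
    by (simp add: algebra_simps)
  then have 1: "z + cnj z * (u * u) - u - u = u * (of_real (2 * \<rho>) - 2)"
    unfolding zr uc by simp
  have "2 * of_real ((a\<^sup>2 + b\<^sup>2) / c\<^sup>2) * (u * u) - 1 - (u * u)\<^sup>2 =
      u\<^sup>2 * (2 * of_real ((a\<^sup>2 + b\<^sup>2) / c\<^sup>2) - (u\<^sup>2 + (cnj u)\<^sup>2)) + (u * cnj u)\<^sup>2 - 1"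
    by (simp add: power2_eq_square algebra_simps)
  then have 2: "2 * of_real ((a\<^sup>2 + b\<^sup>2) / c\<^sup>2) * (u * u) - 1 - (u * u)\<^sup>2 =
      u\<^sup>2 * (2 * of_real ((a\<^sup>2 + b\<^sup>2) / c\<^sup>2) - of_real (2 * Re (u\<^sup>2)))"
    unfolding uc u2 by simp
  have "u\<^sup>2 * of_real ((2 * \<rho> - 2)\<^sup>2) = u\<^sup>2 * of_real (H * (2 * ((a\<^sup>2 + b\<^sup>2) / c\<^sup>2) - 2 * Re (u\<^sup>2)))"
  proof -
    have "u\<^sup>2 * (of_real (2 * \<rho>) - 2)\<^sup>2 =
        u\<^sup>2 * (of_real H * (2 * of_real ((a\<^sup>2 + b\<^sup>2) / c\<^sup>2) - of_real (2 * Re (u\<^sup>2))))"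
      using eq unfolding 1 2 unfolding power_mult_distrib[of u] by (simp only: mult_ac)
    then show ?thesis by simp
  qed
  then have 3: "(2 * \<rho> - 2)\<^sup>2 = H * (2 * ((a\<^sup>2 + b\<^sup>2) / c\<^sup>2) - 2 * Re (u\<^sup>2))"
    using u by (metis mult_left_cancel norm_zero of_real_eq_iff power_eq_0_iff zero_neq_one)
  have un: "(Re u)\<^sup>2 + (Im u)\<^sup>2 = 1" using u cmod_power2[of u] by simp
  have "H * (2 * ((a\<^sup>2 + b\<^sup>2) / c\<^sup>2) - 2 * Re (u\<^sup>2)) * (a * b)\<^sup>2 =
      r\<^sup>2 * (2 * (a\<^sup>2 + b\<^sup>2) - 2 * c\<^sup>2 * Re (u\<^sup>2))"
    unfolding H using ab c by (simp add: field_simps)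
  also have "2 * (a\<^sup>2 + b\<^sup>2) - 2 * c\<^sup>2 * Re (u\<^sup>2) =
      4 * (b\<^sup>2 * (Re u)\<^sup>2 + a\<^sup>2 * (Im u)\<^sup>2)"
    unfolding c Re_power2 using un by algebra
  also have "b\<^sup>2 * (Re u)\<^sup>2 + a\<^sup>2 * (Im u)\<^sup>2 = (a * b)\<^sup>2 * (norm n)\<^sup>2"
    unfolding cmod_power2 n_def using ab by (simp add: field_simps)
  finally have "(a * b)\<^sup>2 * (2 * \<rho> - 2)\<^sup>2 = (a * b)\<^sup>2 * (2 * (r * norm n))\<^sup>2"
    unfolding 3 by (simp add: power_mult_distrib algebra_simps)
  then have 4: "(2 * \<rho> - 2)\<^sup>2 = (2 * (r * norm n))\<^sup>2" using ab by simp
  have "stretch a b z \<in> cball (stretch a b z) r" using r by simp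
  then have "stretch a b z \<in> axis_ellipse_interior a b" using nested by blast
  then have "norm z < 1" using ab by (simp add: stretch_in_axis_ellipse_interior)
  moreover have "\<rho> \<le> norm z"
    using complex_Re_le_cmod[of "z * cnj u"] u by (simp add: \<rho>_def norm_mult)
  ultimately have "\<rho> < 1" by simp
  moreover have "r * norm n \<ge> 0" using r by simp
  ultimately have rn: "r * norm n = 1 - \<rho>"
    using 4 unfolding power2_eq_iff by argo
  then have n0: "norm n > 0" using \<open>\<rho> < 1\<close> r by (metis diff_gt_0_iff_gt zero_less_mult_pos)
  \<comment> \<open>The preimage of the point where the circle touches the tangent of the ellipse.
    It lies on the tangent of the unit circle at \<open>u\<close>, so its norm cannot be below
    1.\<close>
  define y where "y = z + (r / norm n) *\<^sub>R Complex (Re u / a\<^sup>2) (Im u / b\<^sup>2)"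
  have "stretch a b y = stretch a b z + (r / norm n) *\<^sub>R n"
    using ab by (simp add: y_def stretch_def n_def complex_eq_iff power2_eq_square algebra_simps)
  then have "stretch a b y \<in> cball (stretch a b z) r" using n0 r by (simp add: dist_norm)
  then have "stretch a b y \<in> axis_ellipse_interior a b" using nested by blast
  then have "norm y < 1" using ab by (simp add: stretch_in_axis_ellipse_interior)
  moreover have "Re (y * cnj u) = 1"
  proof -
    have "Re (Complex (Re u / a\<^sup>2) (Im u / b\<^sup>2) * cnj u) = (norm n)\<^sup>2"
      unfolding cmod_power2 by (simp add: n_def power2_eq_square)
    moreover have "Re (y * cnj u) = \<rho> + r / norm n * Re (Complex (Re u / a\<^sup>2) (Im u / b\<^sup>2) * cnj u)"
      by (simp add: y_def \<rho>_def algebra_simps)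
    ultimately have "Re (y * cnj u) = \<rho> + r * norm n" using n0 by (simp add: power2_eq_square)
    then show ?thesis using rn by simp
  qed
  moreover have "Re (y * cnj u) \<le> norm y"
    using complex_Re_le_cmod[of "y * cnj u"] u by (simp add: norm_mult)
  ultimately show False by simp
qed

text \<open>Closure after three steps leaves two candidates for \<open>H\<close>; nestedness selects the smaller one.\<close>

lemma quadratic_smaller_root_unique:
  fixes x y M B :: real
  assumes "x\<^sup>2 - B * x + M\<^sup>2 = 0" "y\<^sup>2 - B * y + M\<^sup>2 = 0" "0 < x" "x < M" "0 < y" "y < M"
  shows "x = y"
proof (rule ccontr)
  assume "x \<noteq> y"
  \<comment> \<open>Vieta: two distinct roots have product \<open>M\<^sup>2\<close>, so they cannot
    both be positive and below \<open>M\<close>.\<close>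
  have "(x - y) * (x * y - M\<^sup>2) = 0" using assms(1,2) by algebra
  then have "x * y = M * M" using \<open>x \<noteq> y\<close> by (simp add: power2_eq_square)
  moreover have "x * y < M * M" using assms by (intro mult_strict_mono) auto
  ultimately show False by simp
qed

text \<open>\<open>stretch a b\<close> maps the unit disk onto the region bounded by the ellipse. The preimage of the
  circle with radius \<open>r\<close> about \<open>stretch a b z\<close> is an ellipse with foci \<open>z \<plusminus> \<i> * sqrt H\<close>, where
  \<open>H = (r * c / (a * b))\<^sup>2\<close>, and \<open>m\<close> is the product of these foci. The condition \<open>H_eq\<close> is Cayley's
  condition for closure after three steps.\<close>

locale poncelet_conditions =
  fixes a b c :: real and z m :: complex and H :: real
  assumes b_pos: "b > 0" and b_less_a: "b < a" and c_sq: "c\<^sup>2 = a\<^sup>2 - b\<^sup>2"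
    and H_pos: "H > 0" and m_eq: "m = z\<^sup>2 + of_real H" and norm_m: "norm m < 1"
    and H_eq: "1 - 2 * (norm z)\<^sup>2 + (norm m)\<^sup>2 = 2 * ((a\<^sup>2 + b\<^sup>2) / c\<^sup>2) * H"
begin

section \<open>Triangles of the family and their circumcenters under the closure condition\<close>

lemma ab: "a > 0" "b > 0" "a \<noteq> 0" "b \<noteq> 0"
  using b_pos b_less_a by auto

lemma c0: "c \<noteq> 0" "c\<^sup>2 > 0"
proof -
  show "c\<^sup>2 > 0" using b_pos b_less_a by (simp add: c_sq power_strict_mono)
  then show "c \<noteq> 0" by auto
qed

lemma K_gt_1: "(a\<^sup>2 + b\<^sup>2) / c\<^sup>2 > 1"
proof -
  have "c\<^sup>2 < a\<^sup>2 + b\<^sup>2" using b_pos by (simp add: c_sq)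
  then show ?thesis using c0 by (simp add: less_divide_eq)
qed

lemma foci:
  "norm (z + \<i> * sqrt H) < 1" "norm (z - \<i> * sqrt H) < 1" "(norm z)\<^sup>2 + H < 1"
  using foci_in_unit_disk[OF H_pos real_sqrt_pow2 m_eq norm_m K_gt_1 H_eq] H_pos by auto

lemma norm_z: "norm z < 1"
  using foci(3) H_pos power_less_imp_less_base[of "norm z" 2 1] by simp

lemma cnj_m: "cnj m = (cnj z)\<^sup>2 + of_real H"
  by (simp add: m_eq)

lemma H_eq_complex: "1 - 2 * (z * cnj z) + m * cnj m = 2 * of_real ((a\<^sup>2 + b\<^sup>2) / c\<^sup>2) * of_real H"
proof -
  have "1 - 2 * (z * cnj z) + m * cnj m = of_real (1 - 2 * (norm z)\<^sup>2 + (norm m)\<^sup>2)"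
    by (simp add: complex_norm_square del: of_real_power)
  then show ?thesis unfolding H_eq by simp
qed

text \<open>The radius of a member of the family is not known beforehand. Its three tangencies force
  Cayley's condition for the corresponding \<open>H'\<close>, and nestedness then identifies
  \<open>H'\<close> with \<open>H\<close>, so the sum formula holds with the fixed
  \<open>m\<close>.\<close>

lemma poncelet_family_vieta:
  assumes "(P, Q, R) \<in> poncelet_family a b (stretch a b z)"
  obtains u v w where "P = stretch a b u" "Q = stretch a b v" "R = stretch a b w"
    "norm u = 1" "norm v = 1" "norm w = 1" "u \<noteq> v" "v \<noteq> w" "w \<noteq> u"
    "u + v + w = 2 * z + cnj m * (u * v * w)"
proof -
  obtain u v w where PQR: "P = stretch a b u" "Q = stretch a b v" "R = stretch a b w"
    using stretch_surj ab by metis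
  from assms obtain r where nc: "\<not> collinear {P, Q, R}" and ell: "{P, Q, R} \<subseteq> axis_ellipse a b"
    and r: "r > 0" "cball (stretch a b z) r \<subseteq> axis_ellipse_interior a b"
      "tangent_to_circle (affine hull {P, Q}) (stretch a b z) r"
      "tangent_to_circle (affine hull {Q, R}) (stretch a b z) r"
      "tangent_to_circle (affine hull {R, P}) (stretch a b z) r"
    unfolding poncelet_family_def by auto
  have n: "norm u = 1" "norm v = 1" "norm w = 1"
    using ell ab unfolding PQR by (simp_all add: stretch_in_axis_ellipse)
  have dPQR: "P \<noteq> Q" "Q \<noteq> R" "R \<noteq> P" using nc by (auto simp: insert_commute)
  then have d: "u \<noteq> v" "v \<noteq> w" "w \<noteq> u" unfolding PQR by auto
  define h where "h = r * c / (a * b)"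
  define H' where "H' = h\<^sup>2"
  define m' where "m' = z\<^sup>2 + of_real H'"
  have H': "H' > 0" unfolding H'_def h_def using r c0 ab by simp
  have rel: "(z + cnj z * (u * v) - u - v)\<^sup>2 =
      of_real H' * (2 * of_real ((a\<^sup>2 + b\<^sup>2) / c\<^sup>2) * (u * v) - 1 - (u * v)\<^sup>2)"
    if "norm u = 1" "norm v = 1" "stretch a b u \<noteq> stretch a b v"
      "tangent_to_circle (affine hull {stretch a b u, stretch a b v}) (stretch a b z) r" for u v
    using that r(1) tangent_chord_iff[OF ab(1,2) c_sq c0(1), of u v z r]
    unfolding H'_def h_def by (auto simp: tangent_to_circle_line_iff)
  have nz: "u \<noteq> 0" "v \<noteq> 0" "w \<noteq> 0" using n by auto
  have cm': "cnj m' = (cnj z)\<^sup>2 + of_real H'" by (simp add: m'_def)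
  have rels: "(z + cnj z * (u * v) - u - v)\<^sup>2 =
      of_real H' * (2 * of_real ((a\<^sup>2 + b\<^sup>2) / c\<^sup>2) * (u * v) - 1 - (u * v)\<^sup>2)"
    "(z + cnj z * (v * w) - v - w)\<^sup>2 =
      of_real H' * (2 * of_real ((a\<^sup>2 + b\<^sup>2) / c\<^sup>2) * (v * w) - 1 - (v * w)\<^sup>2)"
    "(z + cnj z * (w * u) - w - u)\<^sup>2 =
      of_real H' * (2 * of_real ((a\<^sup>2 + b\<^sup>2) / c\<^sup>2) * (w * u) - 1 - (w * u)\<^sup>2)"
    using rel n r(3-5) dPQR unfolding PQR by blast+
  have vieta: "u + v + w = 2 * z + cnj m' * (u * v * w)"
    "1 - 2 * (z * cnj z) + m' * cnj m' = 2 * of_real ((a\<^sup>2 + b\<^sup>2) / c\<^sup>2) * of_real H'"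
    using chord_relation_imp_vieta(1,3)[OF d nz m'_def cm' rels] by auto
  have "of_real (1 - 2 * (norm z)\<^sup>2 + (norm m')\<^sup>2) = (of_real (2 * ((a\<^sup>2 + b\<^sup>2) / c\<^sup>2) * H') :: complex)"
    using vieta(2) by (simp add: complex_norm_square del: of_real_power)
  then have H'_eq: "1 - 2 * (norm z)\<^sup>2 + (norm m')\<^sup>2 = 2 * ((a\<^sup>2 + b\<^sup>2) / c\<^sup>2) * H'"
    by (simp only: of_real_eq_iff)
  \<comment> \<open>The foci \<open>z \<plusminus> \<i> * h\<close> are mapped to points at distance
    \<open>b * \<bar>h\<bar> = r * \<bar>c\<bar> / a \<le> r\<close> from the center. They are
    therefore in the nested disk, and their squared norms average to the left-hand side.\<close>
  have "(norm z)\<^sup>2 + H' < 1"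
  proof -
    have "c\<^sup>2 \<le> a\<^sup>2" by (simp add: c_sq)
    then have "\<bar>c\<bar> \<le> a" using ab by (simp add: abs_le_square_iff[symmetric] abs_le_iff)
    then have "b * \<bar>h\<bar> \<le> r"
      using ab r(1) by (simp add: h_def abs_mult field_simps)
    have "norm (z + \<i> * of_real k) < 1" if "\<bar>k\<bar> = \<bar>h\<bar>" for k
    proof -
      have "dist (stretch a b z) (stretch a b (z + \<i> * of_real k)) = b * \<bar>h\<bar>"
        unfolding dist_norm stretch_diff using ab that by (simp add: stretch_def cmod_def abs_mult)
      then have "stretch a b (z + \<i> * of_real k) \<in> cball (stretch a b z) r"
        using \<open>b * \<bar>h\<bar> \<le> r\<close> by simp
      then show ?thesis using r(2) stretch_in_axis_ellipse_interior ab by blast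
    qed
    from this[of h] this[of "- h"] have "(norm (z + \<i> * h))\<^sup>2 < 1" "(norm (z + \<i> * (- h)))\<^sup>2 < 1"
      by (simp_all add: abs_square_less_1)
    moreover have "(norm (z + \<i> * h))\<^sup>2 + (norm (z + \<i> * (- h)))\<^sup>2 = 2 * ((norm z)\<^sup>2 + H')"
      unfolding H'_def cmod_power2 by (simp add: power2_eq_square algebra_simps)
    ultimately show ?thesis by argo
  qed
  \<comment> \<open>Expanded in \<open>x\<close>, the closure condition is a quadratic equation with
    constant term \<open>(1 - (norm z)\<^sup>2)\<^sup>2\<close>.\<close>
  have quad: "x\<^sup>2 - 2 * ((a\<^sup>2 + b\<^sup>2) / c\<^sup>2 - Re (z\<^sup>2)) * x + (1 - (norm z)\<^sup>2)\<^sup>2 = 0"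
    if "1 - 2 * (norm z)\<^sup>2 + (norm (z\<^sup>2 + of_real x))\<^sup>2 = 2 * ((a\<^sup>2 + b\<^sup>2) / c\<^sup>2) * x" for x
  proof -
    have "(norm (z\<^sup>2 + of_real x))\<^sup>2 = ((norm z)\<^sup>2)\<^sup>2 + 2 * x * Re (z\<^sup>2) + x\<^sup>2"
      unfolding cmod_power2 by (simp add: Re_power2 Im_power2) algebra
    then show ?thesis using that by (simp add: power2_eq_square algebra_simps)
  qed
  have "H' = H"
  proof (rule quadratic_smaller_root_unique)
    show "H'\<^sup>2 - 2 * ((a\<^sup>2 + b\<^sup>2) / c\<^sup>2 - Re (z\<^sup>2)) * H' + (1 - (norm z)\<^sup>2)\<^sup>2 = 0"
      by (rule quad[OF H'_eq[unfolded m'_def]])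
    show "H\<^sup>2 - 2 * ((a\<^sup>2 + b\<^sup>2) / c\<^sup>2 - Re (z\<^sup>2)) * H + (1 - (norm z)\<^sup>2)\<^sup>2 = 0"
      by (rule quad[OF H_eq[unfolded m_eq]])
    show "0 < H'" "0 < H" by (fact H') (fact H_pos)
    show "H' < 1 - (norm z)\<^sup>2" "H < 1 - (norm z)\<^sup>2"
      using \<open>(norm z)\<^sup>2 + H' < 1\<close> foci(3) by simp_all
  qed
  then have "m' = m" by (simp add: m'_def m_eq)
  then show ?thesis using that PQR n d vieta(1) by blast
qed

text \<open>The vertices are the roots of the Blaschke cubic with the prescribed product
  \<open>l\<close>. They are unimodular because the foci lie in the disk, their chords are tangent
  by the converse Vieta argument, and they are distinct because a double root contradicts
  nestedness.\<close>

lemma ex_poncelet_triangle: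
  assumes l: "norm l = 1"
  obtains u v w where "norm u = 1" "norm v = 1" "norm w = 1" "u \<noteq> v" "v \<noteq> w" "w \<noteq> u"
    "(stretch a b u, stretch a b v, stretch a b w) \<in> poncelet_family a b (stretch a b z)"
    "u + v + w = 2 * z + cnj m * l" "u * v * w = l"
proof -
  \<comment> \<open>The positive solution of \<open>H = (r * c / (a * b))\<^sup>2\<close>; only the
    square of \<open>c\<close> is prescribed, hence the absolute value.\<close>
  define r where "r = sqrt H * (a * b) / \<bar>c\<bar>"
  have r: "r > 0" "H = (r * c / (a * b))\<^sup>2"
    using ab c0 H_pos by (simp_all add: r_def power_divide power_mult_distrib)
  obtain u v w where s: "u + v + w = 2 * z + cnj m * l"
    "u * v + v * w + w * u = m + 2 * cnj z * l" "u * v * w = l"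
    by (rule monic_cubic_splits)
  have root: "norm x = 1" if "(x - u) * (x - v) * (x - w) = 0" for x
  proof (rule unit_root[OF foci(1,2) l])
    define f where "f = z + \<i> * sqrt H"
    define g where "g = z - \<i> * sqrt H"
    have fg: "f + g = 2 * z" "f * g = m"
      using H_pos by (simp_all add: f_def g_def m_eq power2_eq_square algebra_simps flip: of_real_mult)
    then have fg': "cnj f + cnj g = 2 * cnj z" "cnj f * cnj g = cnj m"
      by (metis complex_cnj_add complex_cnj_mult complex_cnj_numeral)+
    have "x * (x - f) * (x - g) = l * (1 - cnj f * x) * (1 - cnj g * x)"
      using that s fg fg' by algebra
    then show "x * (x - (z + \<i> * sqrt H)) * (x - (z - \<i> * sqrt H)) =
        l * (1 - cnj (z + \<i> * sqrt H) * x) * (1 - cnj (z - \<i> * sqrt H) * x)"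
      by (simp only: f_def g_def)
  qed
  have n: "norm u = 1" "norm v = 1" "norm w = 1"
    by (rule root, simp)+
  have "(u' - z)\<^sup>2 + of_real H \<noteq> 0" if "norm u' = 1" for u'
  proof
    have "(u' - z)\<^sup>2 + of_real H = (u' - (z + \<i> * sqrt H)) * (u' - (z - \<i> * sqrt H))"
      using H_pos by (simp add: power2_eq_square algebra_simps flip: of_real_mult)
    moreover assume "(u' - z)\<^sup>2 + of_real H = 0"
    ultimately have "u' = z + \<i> * sqrt H \<or> u' = z - \<i> * sqrt H" by simp
    then show False using foci(1,2) that by auto
  qed
  then have nested: "cball (stretch a b z) r \<subseteq> axis_ellipse_interior a b"
    using cball_subset_ellipse_interior[OF ab(1,2) norm_z]
      dist_ellipse_gt[OF b_pos b_less_a c_sq r(2) H_pos r(1) m_eq norm_m H_eq] by blast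
  have rel: "(z + cnj z * (u * v) - u - v)\<^sup>2 =
      of_real H * (2 * of_real ((a\<^sup>2 + b\<^sup>2) / c\<^sup>2) * (u * v) - 1 - (u * v)\<^sup>2)"
    if "norm u = 1" "u + v + w = 2 * z + cnj m * l"
      "u * v + v * w + w * u = m + 2 * cnj z * l" "u * v * w = l" for u v w
  proof -
    have "u \<noteq> 0" using that(1) by auto
    then show ?thesis
      using that vieta_imp_chord_relation[OF _ m_eq cnj_m, of u v w "of_real ((a\<^sup>2 + b\<^sup>2) / c\<^sup>2)"]
        H_eq_complex by blast
  qed
  have rels: "(z + cnj z * (u * v) - u - v)\<^sup>2 =
      of_real H * (2 * of_real ((a\<^sup>2 + b\<^sup>2) / c\<^sup>2) * (u * v) - 1 - (u * v)\<^sup>2)"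
    "(z + cnj z * (v * w) - v - w)\<^sup>2 =
      of_real H * (2 * of_real ((a\<^sup>2 + b\<^sup>2) / c\<^sup>2) * (v * w) - 1 - (v * w)\<^sup>2)"
    "(z + cnj z * (w * u) - w - u)\<^sup>2 =
      of_real H * (2 * of_real ((a\<^sup>2 + b\<^sup>2) / c\<^sup>2) * (w * u) - 1 - (w * u)\<^sup>2)"
    using rel[of u v w] rel[of v w u] rel[of w u v] n s by (simp_all add: ac_simps)
  \<comment> \<open>The chord relations hold even for coinciding roots, where they would take the
    form excluded by \<open>no_double_root\<close>.\<close>
  have d: "u \<noteq> v" "v \<noteq> w" "w \<noteq> u"
    using rels n no_double_root[OF ab(1,2) c_sq c0(1) r nested] by metis+
  have tang: "tangent_to_circle (affine hull {stretch a b u, stretch a b v}) (stretch a b z) r"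
    if "norm u = 1" "norm v = 1" "u \<noteq> v"
      "(z + cnj z * (u * v) - u - v)\<^sup>2 =
      of_real H * (2 * of_real ((a\<^sup>2 + b\<^sup>2) / c\<^sup>2) * (u * v) - 1 - (u * v)\<^sup>2)" for u v
  proof -
    have "stretch a b u \<noteq> stretch a b v" using that(3) ab by (simp add: stretch_inj)
    moreover have "r \<ge> 0" using r by simp
    ultimately show ?thesis
      using tangent_chord_iff[OF ab(1,2) c_sq c0(1) that(1-3), of z r, folded r(2)] that(4)
        tangent_to_circle_line_iff by blast
  qed
  have "(stretch a b u, stretch a b v, stretch a b w) \<in> poncelet_family a b (stretch a b z)"
    unfolding poncelet_family_def
    using not_collinear_stretch_unit[OF ab(3,4) n d] r(1) nested n ab
      tang[OF n(1,2) d(1) rels(1)] tang[OF n(2,3) d(2) rels(2)] tang[OF n(3,1) d(3) rels(3)]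
    by (auto simp: stretch_in_axis_ellipse)
  then show ?thesis using that n d s(1,3) by blast
qed

lemma circumcenter_locus_eq:
  "circumcenter_locus a b (stretch a b z) =
    (\<lambda>l. Complex (c\<^sup>2 / (4 * a) * Re (2 * z + cnj m * l + l))
      (- c\<^sup>2 / (4 * b) * Im (2 * z + cnj m * l - l))) ` sphere 0 1" (is "_ = ?X ` _")
proof
  show "circumcenter_locus a b (stretch a b z) \<subseteq> ?X ` sphere 0 1"
  proof
    fix x assume "x \<in> circumcenter_locus a b (stretch a b z)"
    then obtain P Q R where x: "x = circumcenter P Q R"
      and "(P, Q, R) \<in> poncelet_family a b (stretch a b z)"
      unfolding circumcenter_locus_def by blast
    then obtain u v w where uvw: "P = stretch a b u" "Q = stretch a b v" "R = stretch a b w"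
      "norm u = 1" "norm v = 1" "norm w = 1" "u \<noteq> v" "v \<noteq> w" "w \<noteq> u"
      "u + v + w = 2 * z + cnj m * (u * v * w)"
      using poncelet_family_vieta by metis
    have "x = ?X (u * v * w)"
      unfolding x uvw(1-3) circumcenter_stretch_unit[OF ab(3,4) uvw(4-9)] uvw(10) c_sq ..
    moreover have "u * v * w \<in> sphere 0 1" using uvw by (simp add: norm_mult)
    ultimately show "x \<in> ?X ` sphere 0 1" by blast
  qed
  show "?X ` sphere 0 1 \<subseteq> circumcenter_locus a b (stretch a b z)"
  proof
    fix x assume "x \<in> ?X ` sphere 0 1"
    then obtain l where l: "norm l = 1" "x = ?X l" by auto
    obtain u v w where uvw: "norm u = 1" "norm v = 1" "norm w = 1" "u \<noteq> v" "v \<noteq> w" "w \<noteq> u"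
      and fam: "(stretch a b u, stretch a b v, stretch a b w) \<in> poncelet_family a b (stretch a b z)"
      and s: "u + v + w = 2 * z + cnj m * l" "u * v * w = l"
      by (rule ex_poncelet_triangle[OF l(1)])
    have "x = circumcenter (stretch a b u) (stretch a b v) (stretch a b w)"
      unfolding l(2) circumcenter_stretch_unit[OF ab(3,4) uvw] s c_sq ..
    with fam show "x \<in> circumcenter_locus a b (stretch a b z)"
      unfolding circumcenter_locus_def by blast
  qed
qed

text \<open>Up to the factor \<open>c\<^sup>2 / (8 * a * b)\<close>, \<open>A\<close> and
  \<open>B\<close> are the coefficients of \<open>l\<close> and \<open>cnj l\<close> after real and
  imaginary parts are written through conjugates.\<close>

lemma circumcenter_locus_ellipse:
  defines "A \<equiv> of_real (a + b) - of_real (a - b) * cnj m"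
    and "B \<equiv> of_real (a + b) * m - of_real (a - b)"
  assumes "norm B < norm A"
  shows "is_ellipse_with_semi_axes (circumcenter_locus a b (stretch a b z))
    (c\<^sup>2 / (8 * a * b) * (norm A + norm B)) (c\<^sup>2 / (8 * a * b) * (norm A - norm B))"
proof -
  define k where "k = c\<^sup>2 / (8 * a * b)"
  have k: "k > 0" using c0 ab by (simp add: k_def)
  define X where "X = Complex (c\<^sup>2 / (2 * a) * Re z) (- c\<^sup>2 / (2 * b) * Im z)"
  have "Complex (c\<^sup>2 / (4 * a) * Re (2 * z + cnj m * l + l)) (- c\<^sup>2 / (4 * b) * Im (2 * z + cnj m * l - l)) =
      X + (of_real k * A) * l + (of_real k * B) * cnj l" for l
    using ab by (simp add: complex_eq_iff X_def A_def B_def k_def field_simps)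
  then have "circumcenter_locus a b (stretch a b z) =
      (\<lambda>l. X + (of_real k * A) * l + (of_real k * B) * cnj l) ` sphere 0 1"
    unfolding circumcenter_locus_eq by simp
  moreover have "norm (of_real k * B) < norm (of_real k * A)"
    using assms k by (simp add: norm_mult)
  ultimately have "is_ellipse_with_semi_axes (circumcenter_locus a b (stretch a b z))
    (norm (of_real k * A) + norm (of_real k * B)) (norm (of_real k * A) - norm (of_real k * B))"
    using is_ellipse_image_sphere by metis
  then show ?thesis unfolding k_def[symmetric]
    using k by (simp add: norm_mult algebra_simps)
qed

end

section \<open>Centers on the ellipse of centroids and the aspect ratio\<close>

lemma center_parameter:
  fixes a b c :: real
  assumes ab: "b > 0" "b < a" and c: "c\<^sup>2 = a\<^sup>2 - b\<^sup>2"
    and C: "C \<in> axis_ellipse (a * c\<^sup>2 / (a\<^sup>2 + 3 * b\<^sup>2)) (b * c\<^sup>2 / (3 * a\<^sup>2 + b\<^sup>2))"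
  obtains t where "C = stretch a b (Complex (c\<^sup>2 / (a\<^sup>2 + 3 * b\<^sup>2) * cos t) (c\<^sup>2 / (3 * a\<^sup>2 + b\<^sup>2) * sin t))"
proof -
  have c2: "c\<^sup>2 > 0" using ab c by (simp add: power_strict_mono)
  have pos: "a\<^sup>2 + 3 * b\<^sup>2 > 0" "3 * a\<^sup>2 + b\<^sup>2 > 0" using ab by (simp_all add: add_pos_pos)
  let ?p = "a * c\<^sup>2 / (a\<^sup>2 + 3 * b\<^sup>2)" and ?q = "b * c\<^sup>2 / (3 * a\<^sup>2 + b\<^sup>2)"
  have pq: "?p \<noteq> 0" "?q \<noteq> 0" using ab c2 pos by auto
  have "(Re C / ?p)\<^sup>2 + (Im C / ?q)\<^sup>2 = 1" using C unfolding axis_ellipse_def by blast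
  then obtain t where t: "Re C / ?p = cos t" "Im C / ?q = sin t"
    using sincos_total_2pi by metis
  then have "Re C = ?p * cos t" "Im C = ?q * sin t"
    using pq by (metis nonzero_mult_div_cancel_left times_divide_eq_right)+
  then show ?thesis by (intro that[of t]) (simp add: stretch_def complex_eq_iff)
qed

text \<open>For \<open>C\<close> on the ellipse of centroids the family contains an equilateral triangle, whose
  circumcenter is \<open>C\<close> itself. If \<open>cis t\<close> is the product of its three normalized vertices, then
  \<open>m = cnj z * cis t\<close>.\<close>

lemma poncelet_conditions_equilateral:
  fixes a b c t :: real
  defines "z \<equiv> Complex (c\<^sup>2 / (a\<^sup>2 + 3 * b\<^sup>2) * cos t) (c\<^sup>2 / (3 * a\<^sup>2 + b\<^sup>2) * sin t)"
  assumes ab: "b > 0" "b < a" and c: "c\<^sup>2 = a\<^sup>2 - b\<^sup>2"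
  shows "poncelet_conditions a b c z (cnj z * cis t)
    (4 * c\<^sup>2 * (b\<^sup>2 * (cos t)\<^sup>2 / (a\<^sup>2 + 3 * b\<^sup>2)\<^sup>2 + a\<^sup>2 * (sin t)\<^sup>2 / (3 * a\<^sup>2 + b\<^sup>2)\<^sup>2))"
    (is "poncelet_conditions a b c z ?m ?H")
proof
  define p where "p = a\<^sup>2 + 3 * b\<^sup>2"
  define q where "q = 3 * a\<^sup>2 + b\<^sup>2"
  define x where "x = cos t / p"
  define y where "y = sin t / q"
  have c2: "c\<^sup>2 > 0" using ab c by (simp add: power_strict_mono)
  have pq: "p > 0" "q > 0" using ab by (simp_all add: p_def q_def add_pos_pos)
  have z: "z = Complex (c\<^sup>2 * x) (c\<^sup>2 * y)"
    by (simp add: z_def x_def y_def p_def q_def)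
  have xy: "cos t = p * x" "sin t = q * y" using pq by (simp_all add: x_def y_def)
  have one: "(p * x)\<^sup>2 + (q * y)\<^sup>2 = 1" unfolding xy[symmetric] by simp
  have H: "?H = 4 * c\<^sup>2 * (b\<^sup>2 * x\<^sup>2 + a\<^sup>2 * y\<^sup>2)"
    by (simp add: x_def y_def p_def q_def power_divide)
  have nm: "norm ?m = norm z" by (simp add: norm_mult)
  have nz: "(norm z)\<^sup>2 = (c\<^sup>2)\<^sup>2 * (x\<^sup>2 + y\<^sup>2)"
    unfolding cmod_power2 z by (simp add: power_mult_distrib algebra_simps)
  \<comment> \<open>As \<open>norm m = norm z\<close> here, Cayley's condition collapses to this
    identity, which is homogeneous quadratic in \<open>x\<close> and \<open>y\<close> once 1 is
    replaced by \<open>one\<close>.\<close>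
  have K: "1 - (norm z)\<^sup>2 = 2 * (a\<^sup>2 + b\<^sup>2) * (4 * (b\<^sup>2 * x\<^sup>2 + a\<^sup>2 * y\<^sup>2))"
    unfolding nz using one unfolding c p_def q_def by algebra
  have "x \<noteq> 0 \<or> y \<noteq> 0" using one by auto
  then have pos: "b\<^sup>2 * x\<^sup>2 + a\<^sup>2 * y\<^sup>2 > 0"
    using ab by (auto intro: add_pos_nonneg add_nonneg_pos)
  show "b > 0" "b < a" "c\<^sup>2 = a\<^sup>2 - b\<^sup>2" by fact+
  show "?H > 0" unfolding H using pos c2 by simp
  have "Re ?m = Re (z\<^sup>2 + of_real ?H)"
    unfolding H z by (simp add: Re_power2 xy c p_def q_def) algebra
  moreover have "Im ?m = Im (z\<^sup>2 + of_real ?H)"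
    unfolding H z by (simp add: Im_power2 xy c p_def q_def) algebra
  ultimately show "?m = z\<^sup>2 + of_real ?H" by (rule complex_eqI)
  have "1 - (norm z)\<^sup>2 > 0" unfolding K using pos ab by (intro mult_pos_pos add_pos_pos[of "a\<^sup>2"]) auto
  then show "norm ?m < 1" unfolding nm by (simp add: abs_square_less_1)
  show "1 - 2 * (norm z)\<^sup>2 + (norm ?m)\<^sup>2 = 2 * ((a\<^sup>2 + b\<^sup>2) / c\<^sup>2) * ?H"
    unfolding nm H using K c2 by simp
qed

text \<open>Cleared of denominators, the two coefficients are \<open>(a + b)\<^sup>2\<close> and
  \<open>(a - b)\<^sup>2\<close> times the same number \<open>D\<close>, up to a unit factor. The
  scale \<open>k\<close> may vary with \<open>t\<close>, but the ratio of the norms does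
  not.\<close>

lemma norm_locus_coefficients:
  fixes a b c t :: real
  defines "m \<equiv> cnj (Complex (c\<^sup>2 / (a\<^sup>2 + 3 * b\<^sup>2) * cos t) (c\<^sup>2 / (3 * a\<^sup>2 + b\<^sup>2) * sin t)) * cis t"
  assumes ab: "b > 0" "b < a" and c: "c\<^sup>2 = a\<^sup>2 - b\<^sup>2"
  obtains k where "k > 0"
    "norm (of_real (a + b) - of_real (a - b) * cnj m) = k * (a + b)\<^sup>2"
    "norm (of_real (a + b) * m - of_real (a - b)) = k * (a - b)\<^sup>2"
proof -
  define p where "p = a\<^sup>2 + 3 * b\<^sup>2"
  define q where "q = 3 * a\<^sup>2 + b\<^sup>2"
  define e where "e = cis (2 * t)"
  define D where "D = of_real ((a + b)^3) * e - of_real ((a - b)^3)"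
  have pq: "p > 0" "q > 0" using ab by (simp_all add: p_def q_def add_pos_pos)
  have e: "norm e = 1" by (simp add: e_def)
  have sc: "(sin t)\<^sup>2 + (cos t)\<^sup>2 = 1" by simp
  have ms: "m = Complex (c\<^sup>2 / p * cos t) (- (c\<^sup>2 / q * sin t)) * cis t"
    by (simp add: m_def p_def q_def complex_eq_iff)
  have "of_real (p * q) * m = of_real (c\<^sup>2) * (Complex (q * cos t) (- (p * sin t)) * cis t)"
    unfolding ms using pq by (simp add: complex_eq_iff field_simps)
  also have "Complex (q * cos t) (- (p * sin t)) * cis t =
      of_real (2 * (a\<^sup>2 + b\<^sup>2)) + of_real (a\<^sup>2 - b\<^sup>2) * e"
  proof (rule complex_eqI)
    show "Re (Complex (q * cos t) (- (p * sin t)) * cis t) =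
        Re (of_real (2 * (a\<^sup>2 + b\<^sup>2)) + of_real (a\<^sup>2 - b\<^sup>2) * e)"
      unfolding p_def q_def by (simp add: e_def cos_double) (use sc in algebra)
    show "Im (Complex (q * cos t) (- (p * sin t)) * cis t) =
        Im (of_real (2 * (a\<^sup>2 + b\<^sup>2)) + of_real (a\<^sup>2 - b\<^sup>2) * e)"
      unfolding p_def q_def by (simp add: e_def sin_double) algebra
  qed
  finally have m: "of_real (p * q) * m =
      of_real (c\<^sup>2) * (of_real (2 * (a\<^sup>2 + b\<^sup>2)) + of_real (a\<^sup>2 - b\<^sup>2) * e)" .
  have "of_real (p * q) * (of_real (a + b) * m - of_real (a - b)) =
      of_real (a + b) * (of_real (p * q) * m) - of_real (p * q) * of_real (a - b)"
    by (simp add: algebra_simps)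
  also have "\<dots> = of_real ((a - b)\<^sup>2) * D"
    unfolding m unfolding c D_def p_def q_def by (simp add: algebra_simps power2_eq_square power3_eq_cube)
  finally have B: "of_real (p * q) * (of_real (a + b) * m - of_real (a - b)) = of_real ((a - b)\<^sup>2) * D" .
  have m': "of_real (p * q) * cnj m =
      of_real (c\<^sup>2) * (of_real (2 * (a\<^sup>2 + b\<^sup>2)) + of_real (a\<^sup>2 - b\<^sup>2) * cnj e)"
    using arg_cong[OF m, of cnj] by simp
  have ee: "e * cnj e = 1" by (rule cnj_unit[OF e])
  have "of_real (p * q) * (of_real (a + b) - of_real (a - b) * cnj m) =
      of_real (p * q) * of_real (a + b) - of_real (a - b) * (of_real (p * q) * cnj m)"
    by (simp add: algebra_simps)
  also have "\<dots> = of_real ((a + b)\<^sup>2) * (of_real ((a + b)^3) - of_real ((a - b)^3) * cnj e)"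
    unfolding m' unfolding c p_def q_def by (simp add: algebra_simps power2_eq_square power3_eq_cube)
  also have "of_real ((a + b)^3) - of_real ((a - b)^3) * cnj e = cnj e * D"
    unfolding D_def using ee by (simp add: algebra_simps)
  finally have A: "of_real (p * q) * (of_real (a + b) - of_real (a - b) * cnj m) =
      of_real ((a + b)\<^sup>2) * (cnj e * D)" .
  \<comment> \<open>The two terms of \<open>D\<close> have different norms, so \<open>D\<close>
    cannot vanish.\<close>
  have "(a - b)^3 < (a + b)^3" using ab by (intro power_strict_mono) auto
  then have "norm (of_real ((a - b)^3) :: complex) < norm (of_real ((a + b)^3) * e)"
    unfolding norm_mult norm_of_real e using ab by simp
  then have D: "norm D > 0" unfolding D_def by auto
  define k where "k = norm D / (p * q)"
  have nrm: "norm X = s\<^sup>2 * norm Y / (p * q)" if "of_real (p * q) * X = of_real (s\<^sup>2) * Y"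
    for X Y :: complex and s :: real
  proof -
    have "(p * q) * norm X = s\<^sup>2 * norm Y"
      using arg_cong[OF that, of norm] pq by (simp add: norm_mult norm_power)
    then show ?thesis using pq by (simp add: field_simps)
  qed
  show ?thesis
  proof (rule that[of k])
    show "k > 0" using D pq by (simp add: k_def)
    show "norm (of_real (a + b) - of_real (a - b) * cnj m) = k * (a + b)\<^sup>2"
      using nrm[OF A] e by (simp add: k_def norm_mult)
    show "norm (of_real (a + b) * m - of_real (a - b)) = k * (a - b)\<^sup>2"
      using nrm[OF B] by (simp add: k_def)
  qed
qed

theorem proposition12:
  fixes a b c :: real and C :: complex
  assumes "a > b" and "b > 0" and "c\<^sup>2 = a\<^sup>2 - b\<^sup>2"
    and "C \<in> axis_ellipse (a * c\<^sup>2 / (a\<^sup>2 + 3 * b\<^sup>2)) (b * c\<^sup>2 / (3 * a\<^sup>2 + b\<^sup>2))"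
  shows "(\<exists>a3 b3. is_ellipse_with_semi_axes (circumcenter_locus a b C) a3 b3) \<and>
    (\<forall>a3 b3. is_ellipse_with_semi_axes (circumcenter_locus a b C) a3 b3 \<longrightarrow>
      a3 / b3 = ((3 * a\<^sup>2 + b\<^sup>2) * (a\<^sup>2 + 3 * b\<^sup>2) * (a^4 - b^4)) /
        (c\<^sup>2 * (6 * a^5 * b + 20 * a^3 * b^3 + 6 * a * b^5)))"
proof -
  note c = assms(3)
  obtain t where C: "C = stretch a b
      (Complex (c\<^sup>2 / (a\<^sup>2 + 3 * b\<^sup>2) * cos t) (c\<^sup>2 / (3 * a\<^sup>2 + b\<^sup>2) * sin t))"
    using center_parameter[OF assms(2,1,3,4)] .
  define z where "z = Complex (c\<^sup>2 / (a\<^sup>2 + 3 * b\<^sup>2) * cos t) (c\<^sup>2 / (3 * a\<^sup>2 + b\<^sup>2) * sin t)"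
  define m where "m = cnj z * cis t"
  obtain k where k: "k > 0" "norm (of_real (a + b) - of_real (a - b) * cnj m) = k * (a + b)\<^sup>2"
      "norm (of_real (a + b) * m - of_real (a - b)) = k * (a - b)\<^sup>2"
    using norm_locus_coefficients[OF assms(2,1,3), of t] unfolding m_def z_def .
  define g where "g = c\<^sup>2 / (8 * a * b)"
  \<comment> \<open>All dependence on the position of \<open>C\<close> sits in this common factor of
    both semi-axes.\<close>
  define s where "s = g * k"
  have c2: "c\<^sup>2 > 0" using assms by (simp add: power_strict_mono)
  have s: "s > 0" using c2 assms k(1) by (simp add: s_def g_def)
  have "(a - b)\<^sup>2 < (a + b)\<^sup>2" using assms by (intro power_strict_mono) auto
  then have "is_ellipse_with_semi_axes (circumcenter_locus a b C)
      (g * (k * (a + b)\<^sup>2 + k * (a - b)\<^sup>2)) (g * (k * (a + b)\<^sup>2 - k * (a - b)\<^sup>2))"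
    using poncelet_conditions.circumcenter_locus_ellipse[OF
        poncelet_conditions_equilateral[OF assms(2,1,3), of t, folded z_def, folded m_def],
        unfolded k(2,3), folded g_def] k(1)
    unfolding C z_def[symmetric] by simp
  then have ell: "is_ellipse_with_semi_axes (circumcenter_locus a b C)
      (s * ((a + b)\<^sup>2 + (a - b)\<^sup>2)) (s * ((a + b)\<^sup>2 - (a - b)\<^sup>2))"
    by (simp add: s_def algebra_simps)
  have "(s * ((a + b)\<^sup>2 + (a - b)\<^sup>2)) / (s * ((a + b)\<^sup>2 - (a - b)\<^sup>2)) = (a\<^sup>2 + b\<^sup>2) / (2 * a * b)"
  proof -
    have "(a + b)\<^sup>2 + (a - b)\<^sup>2 = 2 * (a\<^sup>2 + b\<^sup>2)" "(a + b)\<^sup>2 - (a - b)\<^sup>2 = 2 * (2 * a * b)"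
      by algebra+
    then show ?thesis using s by (simp only: mult_divide_mult_cancel_left)
  qed
  also have "\<dots> = ((3 * a\<^sup>2 + b\<^sup>2) * (a\<^sup>2 + 3 * b\<^sup>2) * (a^4 - b^4)) /
        (c\<^sup>2 * (6 * a^5 * b + 20 * a^3 * b^3 + 6 * a * b^5))"
  proof -
    \<comment> \<open>The stated fraction is \<open>(a\<^sup>2 + b\<^sup>2) / (2 * a * b)\<close>
      expanded by \<open>c\<^sup>2 * P\<close>.\<close>
    define P where "P = (3 * a\<^sup>2 + b\<^sup>2) * (a\<^sup>2 + 3 * b\<^sup>2)"
    have P: "P > 0" using assms by (simp add: P_def add_pos_pos)
    have "(3 * a\<^sup>2 + b\<^sup>2) * (a\<^sup>2 + 3 * b\<^sup>2) * (a^4 - b^4) = (c\<^sup>2 * P) * (a\<^sup>2 + b\<^sup>2)"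
      unfolding P_def c by algebra
    moreover have "c\<^sup>2 * (6 * a^5 * b + 20 * a^3 * b^3 + 6 * a * b^5) = (c\<^sup>2 * P) * (2 * a * b)"
      unfolding P_def by algebra
    moreover have "c\<^sup>2 * P \<noteq> 0" using c2 P by simp
    ultimately show ?thesis by (simp only: mult_divide_mult_cancel_left not_False_eq_True)
  qed
  finally have "a3 / b3 = ((3 * a\<^sup>2 + b\<^sup>2) * (a\<^sup>2 + 3 * b\<^sup>2) * (a^4 - b^4)) /
        (c\<^sup>2 * (6 * a^5 * b + 20 * a^3 * b^3 + 6 * a * b^5))"
    if "is_ellipse_with_semi_axes (circumcenter_locus a b C) a3 b3" for a3 b3
    using is_ellipse_with_semi_axes_unique[OF ell that] by simp
  then show ?thesis using ell by blast
qed

end
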